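(* Let $\mathcal{T}$ be a triangulated category with several semi-orthogonal decompositions $$\mathcal{T}=\langle A_1,B_1\rangle=\langle A_2,B_2\rangle=\dots=\langle A_n,B_n\rangle .$$ Suppose that the projection functors $\beta_i:\mathcal{T}\to B_i$ (in the $i$-th decomposition) have the property that, for every $i$ and every $j$, $$\beta_i(A_j)\subset A_j,\qquad \beta_i(B_j)\subset B_j .$$ Then there is a semi-orthogonal decomposition $$\mathcal{T}=\langle \mathcal{T}_K\rangle_K,\qquad\text{where}\qquad \mathcal{T}_K=\Big(\bigcap_{i\notin K}A_i\Big)\cap\Big(\bigcap_{i\in K}B_i\Big),$$ and $K$ runs over the subsets of $\{1,\dots,n\}$ in the order of increasing cardinality. In particular, $\mathcal{T}_\emptyset=A_1\cap\dots\cap A_n$ is an admissible subcategory of $\mathcal{T}$.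
   Context: A semi-orthogonal decomposition $\mathcal{T}=\langle \mathcal{A}_1,\dots,\mathcal{A}_m\rangle$ of a triangulated category means strict (closed under isomorphism) full triangulated subcategories $\mathcal{A}_i$ such that $\mathrm{Hom}(\mathcal{A}_j,\mathcal{A}_i)=0$ for $j>i$ and for every object $X\in\mathcal{T}$ there is a sequence of morphisms $0=X_m\to X_{m-1}\to\dots\to X_1\to X_0=X$ such that the cone of $X_i\to X_{i-1}$ lies in $\mathcal{A}_i$ for each $i$. For a decomposition $\mathcal{T}=\langle A,B\rangle$, the projection functor $\beta:\mathcal{T}\to B$ is the right adjoint of the inclusion $B\subset\mathcal{T}$: every $X\in\mathcal{T}$ fits into a distinguished triangle $\beta(X)\to X\to Y\to$ with $\beta(X)\in B$ and $Y\in A$. A full triangulated subcategory of $\mathcal{T}$ is admissible if its inclusion functor into $\mathcal{T}$ has both a left adjoint and a right adjoint.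
   Formalization: The final claim fails as stated (for n=1 it says A_1 is always admissible); instead, the intersection of the A_i is shown to have a left adjoint to its inclusion in general, and to be admissible when all A_i are admissible. *)

theory Defs
  imports "HOL-Algebra.Group"
begin

section \<open>Categories, functors, adjunctions\<close>

text \<open>Composition is written in the usual order: \<open>Comp C g f\<close> is \<open>g\<close> after \<open>f\<close>.
  Hom-sets of different pairs of objects are disjoint, so that composition, and the action of
  a functor on morphisms, need not be indexed by objects.\<close>

record ('o, 'm) cat =
  Ob :: "'o set"
  Mor :: "'o \<Rightarrow> 'o \<Rightarrow> 'm set"
  Comp :: "'m \<Rightarrow> 'm \<Rightarrow> 'm"
  Ident :: "'o \<Rightarrow> 'm"

locale category =
  fixes C :: "('o, 'm, 'z) cat_scheme"
  assumes Ident_in: "X \<in> Ob C \<Longrightarrow> Ident C X \<in> Mor C X X"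
    and Comp_in: "\<lbrakk>X \<in> Ob C; Y \<in> Ob C; Z \<in> Ob C; f \<in> Mor C X Y; g \<in> Mor C Y Z\<rbrakk>
      \<Longrightarrow> Comp C g f \<in> Mor C X Z"
    and Comp_Ident_right: "\<lbrakk>X \<in> Ob C; Y \<in> Ob C; f \<in> Mor C X Y\<rbrakk> \<Longrightarrow> Comp C f (Ident C X) = f"
    and Comp_Ident_left: "\<lbrakk>X \<in> Ob C; Y \<in> Ob C; f \<in> Mor C X Y\<rbrakk> \<Longrightarrow> Comp C (Ident C Y) f = f"
    and Comp_assoc: "\<lbrakk>W \<in> Ob C; X \<in> Ob C; Y \<in> Ob C; Z \<in> Ob C;
        f \<in> Mor C W X; g \<in> Mor C X Y; h \<in> Mor C Y Z\<rbrakk>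
      \<Longrightarrow> Comp C h (Comp C g f) = Comp C (Comp C h g) f"
    and Mor_disjoint: "\<lbrakk>X \<in> Ob C; Y \<in> Ob C; X' \<in> Ob C; Y' \<in> Ob C;
        f \<in> Mor C X Y; f \<in> Mor C X' Y'\<rbrakk> \<Longrightarrow> X = X' \<and> Y = Y'"

definition inverse_morphisms :: "('o, 'm, 'z) cat_scheme \<Rightarrow> 'o \<Rightarrow> 'o \<Rightarrow> 'm \<Rightarrow> 'm \<Rightarrow> bool" where
  "inverse_morphisms C X Y f g \<longleftrightarrow> f \<in> Mor C X Y \<and> g \<in> Mor C Y X \<and>
     Comp C g f = Ident C X \<and> Comp C f g = Ident C Y"

definition is_iso :: "('o, 'm, 'z) cat_scheme \<Rightarrow> 'o \<Rightarrow> 'o \<Rightarrow> 'm \<Rightarrow> bool" where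
  "is_iso C X Y f \<longleftrightarrow> (\<exists>g. inverse_morphisms C X Y f g)"

definition isomorphic :: "('o, 'm, 'z) cat_scheme \<Rightarrow> 'o \<Rightarrow> 'o \<Rightarrow> bool" where
  "isomorphic C X Y \<longleftrightarrow> (\<exists>f. is_iso C X Y f)"

definition full_subcategory :: "('o, 'm, 'z) cat_scheme \<Rightarrow> 'o set \<Rightarrow> ('o, 'm, 'z) cat_scheme" where
  "full_subcategory C S = C\<lparr>Ob := S\<rparr>"

record ('o, 'm, 'p, 'q) cfunctor =
  obj_map :: "'o \<Rightarrow> 'p"
  mor_map :: "'m \<Rightarrow> 'q"

definition is_functor ::
    "('o, 'm, 'y) cat_scheme \<Rightarrow> ('p, 'q, 'z) cat_scheme \<Rightarrow> ('o, 'm, 'p, 'q) cfunctor \<Rightarrow> bool" where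
  "is_functor C D F \<longleftrightarrow>
     (\<forall>X \<in> Ob C. obj_map F X \<in> Ob D) \<and>
     (\<forall>X \<in> Ob C. \<forall>Y \<in> Ob C. \<forall>f \<in> Mor C X Y. mor_map F f \<in> Mor D (obj_map F X) (obj_map F Y)) \<and>
     (\<forall>X \<in> Ob C. mor_map F (Ident C X) = Ident D (obj_map F X)) \<and>
     (\<forall>X \<in> Ob C. \<forall>Y \<in> Ob C. \<forall>Z \<in> Ob C. \<forall>f \<in> Mor C X Y. \<forall>g \<in> Mor C Y Z.
        mor_map F (Comp C g f) = Comp D (mor_map F g) (mor_map F f))"

definition inclusion_functor :: "('o, 'm, 'o, 'm) cfunctor" where
  "inclusion_functor = \<lparr>obj_map = (\<lambda>X. X), mor_map = (\<lambda>f. f)\<rparr>"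

definition is_equivalence ::
    "('o, 'm, 'y) cat_scheme \<Rightarrow> ('p, 'q, 'z) cat_scheme \<Rightarrow> ('o, 'm, 'p, 'q) cfunctor \<Rightarrow> bool" where
  "is_equivalence C D F \<longleftrightarrow> is_functor C D F \<and>
     (\<forall>X \<in> Ob C. \<forall>Y \<in> Ob C.
        bij_betw (mor_map F) (Mor C X Y) (Mor D (obj_map F X) (obj_map F Y))) \<and>
     (\<forall>Y \<in> Ob D. \<exists>X \<in> Ob C. isomorphic D (obj_map F X) Y)"

text \<open>\<open>adjunction C D F G\<close>: the functor \<open>F\<close> from \<open>C\<close> to \<open>D\<close> is left adjoint to the functor \<open>G\<close>
  from \<open>D\<close> to \<open>C\<close>, via bijections from \<open>Mor D (F X) Y\<close> to \<open>Mor C X (G Y)\<close> natural in \<open>X\<close> and \<open>Y\<close>.\<close>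

definition adjunction ::
    "('o, 'm, 'y) cat_scheme \<Rightarrow> ('p, 'q, 'z) cat_scheme
      \<Rightarrow> ('o, 'm, 'p, 'q) cfunctor \<Rightarrow> ('p, 'q, 'o, 'm) cfunctor \<Rightarrow> bool" where
  "adjunction C D F G \<longleftrightarrow> is_functor C D F \<and> is_functor D C G \<and>
     (\<exists>\<Phi> :: 'o \<Rightarrow> 'p \<Rightarrow> 'q \<Rightarrow> 'm.
        (\<forall>X \<in> Ob C. \<forall>Y \<in> Ob D.
           bij_betw (\<Phi> X Y) (Mor D (obj_map F X) Y) (Mor C X (obj_map G Y))) \<and>
        (\<forall>X \<in> Ob C. \<forall>X' \<in> Ob C. \<forall>Y \<in> Ob D. \<forall>Y' \<in> Ob D.
           \<forall>u \<in> Mor C X' X. \<forall>h \<in> Mor D (obj_map F X) Y. \<forall>v \<in> Mor D Y Y'.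
             \<Phi> X' Y' (Comp D v (Comp D h (mor_map F u)))
               = Comp C (mor_map G v) (Comp C (\<Phi> X Y h) u)))"

section \<open>Triangulated categories\<close>

text \<open>A distinguished triangle \<open>X \<rightarrow> Y \<rightarrow> Z \<rightarrow> X[1]\<close> with morphisms \<open>f\<close>, \<open>g\<close>, \<open>h\<close> is stored as
  \<open>(X, Y, Z, f, g, h)\<close>.\<close>

record ('o, 'm) tricat = "('o, 'm) cat" +
  Add :: "'o \<Rightarrow> 'o \<Rightarrow> 'm \<Rightarrow> 'm \<Rightarrow> 'm"
  Zero :: "'o \<Rightarrow> 'o \<Rightarrow> 'm"
  Shift :: "('o, 'm, 'o, 'm) cfunctor"
  Dist :: "('o \<times> 'o \<times> 'o \<times> 'm \<times> 'm \<times> 'm) set"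

text \<open>The abelian group of morphisms; the fields of \<^typ>\<open>'m monoid\<close> are named multiplicatively, so
  \<open>inv\<close> in this group is the negative of a morphism.\<close>

definition Mor_group :: "('o, 'm) tricat \<Rightarrow> 'o \<Rightarrow> 'o \<Rightarrow> 'm monoid" where
  "Mor_group T X Y = \<lparr>carrier = Mor T X Y, mult = Add T X Y, one = Zero T X Y\<rparr>"

definition is_zero_object :: "('o, 'm) tricat \<Rightarrow> 'o \<Rightarrow> bool" where
  "is_zero_object T X \<longleftrightarrow> X \<in> Ob T \<and> Ident T X = Zero T X X"

definition is_biproduct :: "('o, 'm) tricat \<Rightarrow> 'o \<Rightarrow> 'o \<Rightarrow> 'o \<Rightarrow> bool" where
  "is_biproduct T X Y S \<longleftrightarrow> S \<in> Ob T \<and>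
     (\<exists>i \<in> Mor T X S. \<exists>j \<in> Mor T Y S. \<exists>p \<in> Mor T S X. \<exists>q \<in> Mor T S Y.
        Comp T p i = Ident T X \<and> Comp T q j = Ident T Y \<and>
        Comp T p j = Zero T Y X \<and> Comp T q i = Zero T X Y \<and>
        Add T S S (Comp T i p) (Comp T j q) = Ident T S)"

locale additive_category = category T for T :: "('o, 'm) tricat" +
  assumes Mor_comm_group: "\<lbrakk>X \<in> Ob T; Y \<in> Ob T\<rbrakk> \<Longrightarrow> comm_group (Mor_group T X Y)"
    and Comp_Add_right: "\<lbrakk>X \<in> Ob T; Y \<in> Ob T; Z \<in> Ob T;
        f \<in> Mor T X Y; f' \<in> Mor T X Y; g \<in> Mor T Y Z\<rbrakk>
      \<Longrightarrow> Comp T g (Add T X Y f f') = Add T X Z (Comp T g f) (Comp T g f')"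
    and Comp_Add_left: "\<lbrakk>X \<in> Ob T; Y \<in> Ob T; Z \<in> Ob T;
        f \<in> Mor T X Y; g \<in> Mor T Y Z; g' \<in> Mor T Y Z\<rbrakk>
      \<Longrightarrow> Comp T (Add T Y Z g g') f = Add T X Z (Comp T g f) (Comp T g' f)"
    and zero_object_exists: "\<exists>N. is_zero_object T N"
    and biproduct_exists: "\<lbrakk>X \<in> Ob T; Y \<in> Ob T\<rbrakk> \<Longrightarrow> \<exists>S. is_biproduct T X Y S"

abbreviation shift_ob :: "('o, 'm) tricat \<Rightarrow> 'o \<Rightarrow> 'o" where
  "shift_ob T \<equiv> obj_map (Shift T)"

abbreviation shift_mor :: "('o, 'm) tricat \<Rightarrow> 'm \<Rightarrow> 'm" where
  "shift_mor T \<equiv> mor_map (Shift T)"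

definition is_triangle :: "('o, 'm) tricat \<Rightarrow> 'o \<times> 'o \<times> 'o \<times> 'm \<times> 'm \<times> 'm \<Rightarrow> bool" where
  "is_triangle T = (\<lambda>(X, Y, Z, f, g, h). X \<in> Ob T \<and> Y \<in> Ob T \<and> Z \<in> Ob T \<and>
     f \<in> Mor T X Y \<and> g \<in> Mor T Y Z \<and> h \<in> Mor T Z (shift_ob T X))"

text \<open>The shift is an additive autoequivalence, not necessarily an automorphism. The rotation axiom
  is stated as an equivalence; the octahedral axiom is the last one.\<close>

locale triangulated_category = additive_category T for T :: "('o, 'm) tricat" +
  assumes Shift_equivalence: "is_equivalence T T (Shift T)"
    and Shift_additive: "\<lbrakk>X \<in> Ob T; Y \<in> Ob T; f \<in> Mor T X Y; f' \<in> Mor T X Y\<rbrakk>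
      \<Longrightarrow> shift_mor T (Add T X Y f f')
            = Add T (shift_ob T X) (shift_ob T Y) (shift_mor T f) (shift_mor T f')"
    and Dist_triangle: "t \<in> Dist T \<Longrightarrow> is_triangle T t"
    and Dist_iso: "\<lbrakk>(X, Y, Z, f, g, h) \<in> Dist T; is_triangle T (X', Y', Z', f', g', h');
        is_iso T X X' a; is_iso T Y Y' b; is_iso T Z Z' c;
        Comp T f' a = Comp T b f; Comp T g' b = Comp T c g;
        Comp T h' c = Comp T (shift_mor T a) h\<rbrakk>
      \<Longrightarrow> (X', Y', Z', f', g', h') \<in> Dist T"
    and Dist_Ident: "\<lbrakk>X \<in> Ob T; is_zero_object T N\<rbrakk>
      \<Longrightarrow> (X, X, N, Ident T X, Zero T X N, Zero T N (shift_ob T X)) \<in> Dist T"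
    and cone_exists: "\<lbrakk>X \<in> Ob T; Y \<in> Ob T; f \<in> Mor T X Y\<rbrakk>
      \<Longrightarrow> \<exists>Z g h. (X, Y, Z, f, g, h) \<in> Dist T"
    and Dist_rotate: "is_triangle T (X, Y, Z, f, g, h)
      \<Longrightarrow> (X, Y, Z, f, g, h) \<in> Dist T \<longleftrightarrow>
          (Y, Z, shift_ob T X, g, h,
             inv\<^bsub>Mor_group T (shift_ob T X) (shift_ob T Y)\<^esub> (shift_mor T f)) \<in> Dist T"
    and Dist_complete: "\<lbrakk>(X, Y, Z, f, g, h) \<in> Dist T; (X', Y', Z', f', g', h') \<in> Dist T;
        a \<in> Mor T X X'; b \<in> Mor T Y Y'; Comp T f' a = Comp T b f\<rbrakk>
      \<Longrightarrow> \<exists>c \<in> Mor T Z Z'. Comp T g' b = Comp T c g \<and> Comp T h' c = Comp T (shift_mor T a) h"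
    and octahedron: "\<lbrakk>(X, Y, Z', f, f1, f2) \<in> Dist T; (Y, Z, X', g, g1, g2) \<in> Dist T;
        (X, Z, Y', Comp T g f, k1, k2) \<in> Dist T\<rbrakk>
      \<Longrightarrow> \<exists>u \<in> Mor T Z' Y'. \<exists>v \<in> Mor T Y' X'.
            (Z', Y', X', u, v, Comp T (shift_mor T f1) g2) \<in> Dist T \<and>
            Comp T u f1 = Comp T k1 g \<and> Comp T k2 u = f2 \<and>
            Comp T v k1 = g1 \<and> Comp T g2 v = Comp T (shift_mor T f) k2"

section \<open>Subcategories and semi-orthogonal decompositions\<close>

text \<open>A full subcategory is given by its set of objects. By strictness the condition on cones does
  not depend on the choice of a cone; the equivalence for the shift covers the inverse shift.\<close>

definition strict_triangulated_subcategory :: "('o, 'm) tricat \<Rightarrow> 'o set \<Rightarrow> bool" where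
  "strict_triangulated_subcategory T S \<longleftrightarrow>
     S \<subseteq> Ob T \<and> S \<noteq> {} \<and>
     (\<forall>X \<in> S. \<forall>Y \<in> Ob T. isomorphic T X Y \<longrightarrow> Y \<in> S) \<and>
     (\<forall>X \<in> Ob T. shift_ob T X \<in> S \<longleftrightarrow> X \<in> S) \<and>
     (\<forall>X Y Z f g h. (X, Y, Z, f, g, h) \<in> Dist T \<and> X \<in> S \<and> Y \<in> S \<longrightarrow> Z \<in> S)"

definition left_adjoint_of_inclusion ::
    "('o, 'm) tricat \<Rightarrow> 'o set \<Rightarrow> ('o, 'm, 'o, 'm) cfunctor \<Rightarrow> bool" where
  "left_adjoint_of_inclusion T S L \<longleftrightarrow> adjunction T (full_subcategory T S) L inclusion_functor"

definition right_adjoint_of_inclusion ::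
    "('o, 'm) tricat \<Rightarrow> 'o set \<Rightarrow> ('o, 'm, 'o, 'm) cfunctor \<Rightarrow> bool" where
  "right_adjoint_of_inclusion T S R \<longleftrightarrow> adjunction (full_subcategory T S) T inclusion_functor R"

text \<open>The first component of a semi-orthogonal decomposition is always left admissible, but in
  general its inclusion need not have a right adjoint.\<close>

definition left_admissible :: "('o, 'm) tricat \<Rightarrow> 'o set \<Rightarrow> bool" where
  "left_admissible T S \<longleftrightarrow>
     strict_triangulated_subcategory T S \<and> (\<exists>L. left_adjoint_of_inclusion T S L)"

definition admissible :: "('o, 'm) tricat \<Rightarrow> 'o set \<Rightarrow> bool" where
  "admissible T S \<longleftrightarrow> strict_triangulated_subcategory T S \<and>
     (\<exists>L. left_adjoint_of_inclusion T S L) \<and> (\<exists>R. right_adjoint_of_inclusion T S R)"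

text \<open>The list \<open>[S\<^sub>1, \<dots>, S\<^sub>m]\<close> is indexed from \<open>0\<close>, so the cone of
  \<open>X\<^sub>i\<^sub>+\<^sub>1 \<rightarrow> X\<^sub>i\<close> is required to lie in \<open>Ss ! i\<close>.\<close>

definition semiorthogonal_decomposition :: "('o, 'm) tricat \<Rightarrow> 'o set list \<Rightarrow> bool" where
  "semiorthogonal_decomposition T Ss \<longleftrightarrow>
     (\<forall>S \<in> set Ss. strict_triangulated_subcategory T S) \<and>
     (\<forall>i j. i < j \<and> j < length Ss \<longrightarrow>
        (\<forall>X \<in> Ss ! j. \<forall>Y \<in> Ss ! i. Mor T X Y = {Zero T X Y})) \<and>
     (\<forall>X \<in> Ob T. \<exists>Xs :: nat \<Rightarrow> 'o. Xs 0 = X \<and> is_zero_object T (Xs (length Ss)) \<and>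
        (\<forall>i < length Ss. \<exists>Z f g h. (Xs (Suc i), Xs i, Z, f, g, h) \<in> Dist T \<and> Z \<in> Ss ! i))"

text \<open>The projection functor of a decomposition \<open>\<langle>A, B\<rangle>\<close> onto \<open>B\<close>.\<close>

abbreviation projection_functor ::
    "('o, 'm) tricat \<Rightarrow> 'o set \<Rightarrow> ('o, 'm, 'o, 'm) cfunctor \<Rightarrow> bool" where
  "projection_functor \<equiv> right_adjoint_of_inclusion"

definition piece :: "('o, 'm) tricat \<Rightarrow> nat \<Rightarrow> (nat \<Rightarrow> 'o set) \<Rightarrow> (nat \<Rightarrow> 'o set) \<Rightarrow> nat set \<Rightarrow> 'o set" where
  "piece T n A B K = {X \<in> Ob T. (\<forall>i \<in> {1..n} - K. X \<in> A i) \<and> (\<forall>i \<in> K. X \<in> B i)}"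

end

(* For X let b -> X -> a be the triangle of the decomposition <A_i, B_i>. Since b is isomorphic to
   beta_i(X), the triangle stays inside every A_j and every B_j that contains X. Decomposing with
   respect to i = 1, ..., n in turn therefore filters every object by the pieces T_K, in some order.
   Different pieces are orthogonal in one direction at least, and where Hom(U, V) = 0 holds for
   adjacent pieces U, V of a filtration, the extensions of U by V split, so U and V can be exchanged;
   this sorts the filtration into any order in which the pieces are semi-orthogonal.

   The left adjoint of the inclusion of the intersection of the A_i is the composite of the left
   adjoints, because each of them preserves all A_j. The right adjoint of A_i, if it exists,
   preserves A_j as well: A_j is the right orthogonal of B_j, and the left adjoint of A_i preserves
   B_j. *)

theory Submission
  imports Defs "HOL-Library.Multiset"
begin

section \<open>Adjoints of inclusions from universal arrows\<close>

text \<open>The value \<open>R\<close> at the single object \<open>X\<close> of a right adjoint of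
  the inclusion of \<open>S\<close>, with its counit \<open>e\<close>, recorded as a universal
  arrow. No functor is involved, so adjoints can be built, compared and intersected one object at a
  time.\<close>

definition coreflection :: "('o, 'm, 'z) cat_scheme \<Rightarrow> 'o set \<Rightarrow> 'o \<Rightarrow> 'o \<Rightarrow> 'm \<Rightarrow> bool" where
  "coreflection C S X R e \<longleftrightarrow> R \<in> S \<and> e \<in> Mor C R X \<and>
     (\<forall>Y \<in> S. bij_betw (Comp C e) (Mor C Y R) (Mor C Y X))"

lemma coreflection_inj:
  assumes "coreflection C S X R e" "Y \<in> S" "u \<in> Mor C Y R" "v \<in> Mor C Y R"
    and "Comp C e u = Comp C e v"
  shows "u = v"
  using assms unfolding coreflection_def bij_betw_def inj_on_def by blast

lemma coreflection_surj:
  assumes "coreflection C S X R e" "Y \<in> S" "k \<in> Mor C Y X"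
  shows "\<exists>u \<in> Mor C Y R. Comp C e u = k"
proof -
  have "k \<in> Comp C e ` Mor C Y R"
    using assms unfolding coreflection_def bij_betw_def by blast
  then show ?thesis by blast
qed

lemma adjunctionE:
  assumes "adjunction C D F G"
  obtains \<Phi> where
    "\<And>X Y. \<lbrakk>X \<in> Ob C; Y \<in> Ob D\<rbrakk>
      \<Longrightarrow> bij_betw (\<Phi> X Y) (Mor D (obj_map F X) Y) (Mor C X (obj_map G Y))"
    "\<And>X X' Y Y' u h v. \<lbrakk>X \<in> Ob C; X' \<in> Ob C; Y \<in> Ob D; Y' \<in> Ob D; u \<in> Mor C X' X;
        h \<in> Mor D (obj_map F X) Y; v \<in> Mor D Y Y'\<rbrakk>
      \<Longrightarrow> \<Phi> X' Y' (Comp D v (Comp D h (mor_map F u)))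
        = Comp C (mor_map G v) (Comp C (\<Phi> X Y h) u)"
proof -
  obtain \<Phi> where \<Phi>:
    "\<forall>X \<in> Ob C. \<forall>Y \<in> Ob D.
      bij_betw (\<Phi> X Y) (Mor D (obj_map F X) Y) (Mor C X (obj_map G Y))"
    "\<forall>X \<in> Ob C. \<forall>X' \<in> Ob C. \<forall>Y \<in> Ob D. \<forall>Y' \<in> Ob D.
       \<forall>u \<in> Mor C X' X. \<forall>h \<in> Mor D (obj_map F X) Y. \<forall>v \<in> Mor D Y Y'.
         \<Phi> X' Y' (Comp D v (Comp D h (mor_map F u))) = Comp C (mor_map G v) (Comp C (\<Phi> X Y h) u)"
    using assms unfolding adjunction_def by (elim conjE exE)
  show thesis by (rule that[of \<Phi>]) (use \<Phi> in simp_all)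
qed

context category
begin

text \<open>Choose a coreflection for every object; the universal property then forces the action on
  morphisms. Functoriality and naturality hold because two morphisms into \<open>R X\<close> from an
  object of \<open>S\<close> are equal as soon as they agree after composition with
  \<open>e X\<close>.\<close>

lemma right_adjoint_of_coreflections:
  assumes S: "S \<subseteq> Ob C" and ex: "\<And>X. X \<in> Ob C \<Longrightarrow> \<exists>R e. coreflection C S X R e"
  shows "\<exists>G. adjunction (full_subcategory C S) C inclusion_functor G"
proof -
  obtain R e where cr: "\<And>X. X \<in> Ob C \<Longrightarrow> coreflection C S X (R X) (e X)"
    using ex by metis
  have R: "R X \<in> S" and RO: "R X \<in> Ob C" and e: "e X \<in> Mor C (R X) X" if "X \<in> Ob C" for X
    using cr[OF that] S unfolding coreflection_def by auto
  define lift where "lift Y X k = (SOME u. u \<in> Mor C Y (R X) \<and> Comp C (e X) u = k)" for Y X k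
  have lift: "lift Y X k \<in> Mor C Y (R X)" "Comp C (e X) (lift Y X k) = k"
    if "X \<in> Ob C" "Y \<in> S" "k \<in> Mor C Y X" for X Y k
    using someI_ex[of "\<lambda>u. u \<in> Mor C Y (R X) \<and> Comp C (e X) u = k"]
      coreflection_surj[OF cr[OF that(1)] that(2,3)] unfolding lift_def by blast+
  \<comment> \<open>The functor acts on a bare morphism, so source and target have to be recovered
    from \<open>f\<close>; disjointness of the Hom-sets makes them unique.\<close>
  define mm where "mm f = (SOME u. \<exists>X \<in> Ob C. \<exists>Y \<in> Ob C. f \<in> Mor C X Y \<and>
    u \<in> Mor C (R X) (R Y) \<and> Comp C (e Y) u = Comp C f (e X))" for f
  have mm: "mm f \<in> Mor C (R X) (R Y)" "Comp C (e Y) (mm f) = Comp C f (e X)"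
    if X: "X \<in> Ob C" and Y: "Y \<in> Ob C" and f: "f \<in> Mor C X Y" for X Y f
  proof -
    have "Comp C f (e X) \<in> Mor C (R X) Y"
      using Comp_in[OF RO[OF X] X Y e[OF X] f] .
    then have "\<exists>u. \<exists>X \<in> Ob C. \<exists>Y \<in> Ob C. f \<in> Mor C X Y \<and>
      u \<in> Mor C (R X) (R Y) \<and> Comp C (e Y) u = Comp C f (e X)"
      using lift[OF Y R[OF X]] X Y f by blast
    from someI_ex[OF this, folded mm_def]
    obtain X' Y' where "X' \<in> Ob C" "Y' \<in> Ob C" "f \<in> Mor C X' Y'"
      "mm f \<in> Mor C (R X') (R Y') \<and> Comp C (e Y') (mm f) = Comp C f (e X')"
      by blast
    moreover from this have "X' = X \<and> Y' = Y"
      using Mor_disjoint X Y f by blast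
    ultimately show "mm f \<in> Mor C (R X) (R Y)" "Comp C (e Y) (mm f) = Comp C f (e X)"
      by auto
  qed
  have mm_Ident: "mm (Ident C X) = Ident C (R X)" if X: "X \<in> Ob C" for X
  proof (rule coreflection_inj[OF cr[OF X] R[OF X]])
    show "Comp C (e X) (mm (Ident C X)) = Comp C (e X) (Ident C (R X))"
      using mm[OF X X Ident_in[OF X]] Comp_Ident_left[OF RO[OF X] X e[OF X]]
        Comp_Ident_right[OF RO[OF X] X e[OF X]] by simp
  qed (use mm[OF X X Ident_in[OF X]] Ident_in[OF RO[OF X]] in auto)
  have mm_Comp: "mm (Comp C g f) = Comp C (mm g) (mm f)"
    if X: "X \<in> Ob C" and Y: "Y \<in> Ob C" and Z: "Z \<in> Ob C"
      and f: "f \<in> Mor C X Y" and g: "g \<in> Mor C Y Z" for X Y Z f g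
  proof (rule coreflection_inj[OF cr[OF Z] R[OF X]])
    note gf = Comp_in[OF X Y Z f g]
    show "mm (Comp C g f) \<in> Mor C (R X) (R Z)" using mm[OF X Z gf] by simp
    show "Comp C (mm g) (mm f) \<in> Mor C (R X) (R Z)"
      using Comp_in[OF RO[OF X] RO[OF Y] RO[OF Z] mm(1)[OF X Y f] mm(1)[OF Y Z g]] .
    have "Comp C (e Z) (Comp C (mm g) (mm f)) = Comp C (Comp C g (e Y)) (mm f)"
      using Comp_assoc[OF RO[OF X] RO[OF Y] RO[OF Z] Z mm(1)[OF X Y f] mm(1)[OF Y Z g] e[OF Z]]
        mm(2)[OF Y Z g] by simp
    also have "\<dots> = Comp C g (Comp C f (e X))"
      using Comp_assoc[OF RO[OF X] RO[OF Y] Y Z mm(1)[OF X Y f] e[OF Y] g] mm(2)[OF X Y f] by simp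
    also have "\<dots> = Comp C (e Z) (mm (Comp C g f))"
      using Comp_assoc[OF RO[OF X] X Y Z e[OF X] f g] mm(2)[OF X Z gf] by simp
    finally show "Comp C (e Z) (mm (Comp C g f)) = Comp C (e Z) (Comp C (mm g) (mm f))" by simp
  qed
  define G where "G = \<lparr>obj_map = R, mor_map = mm\<rparr>"
  have "is_functor C (full_subcategory C S) G"
    unfolding is_functor_def full_subcategory_def G_def
    using R mm(1) mm_Ident mm_Comp by simp
  moreover have "is_functor (full_subcategory C S) C inclusion_functor"
    unfolding is_functor_def full_subcategory_def inclusion_functor_def
    using S by auto
  \<comment> \<open>The adjunction bijection is \<open>lift\<close>, the inverse of composition with
    the counit.\<close>
  moreover have "bij_betw (lift X Y) (Mor C X Y) (Mor C X (R Y))"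
    if X: "X \<in> S" and Y: "Y \<in> Ob C" for X Y
  proof (rule bij_betw_byWitness[where f' = "Comp C (e Y)"])
    have XO: "X \<in> Ob C" using X S by auto
    have c: "Comp C (e Y) k \<in> Mor C X Y" if "k \<in> Mor C X (R Y)" for k
      using Comp_in[OF XO RO[OF Y] Y that e[OF Y]] .
    then show "Comp C (e Y) ` Mor C X (R Y) \<subseteq> Mor C X Y" by auto
    show "lift X Y ` Mor C X Y \<subseteq> Mor C X (R Y)" using lift X Y by auto
    show "\<forall>a\<in>Mor C X Y. Comp C (e Y) (lift X Y a) = a" using lift X Y by auto
    show "\<forall>a'\<in>Mor C X (R Y). lift X Y (Comp C (e Y) a') = a'"
      using coreflection_inj[OF cr[OF Y] X] lift[OF Y X c] by blast
  qed
  moreover have "lift X' Y' (Comp C v (Comp C h u)) = Comp C (mm v) (Comp C (lift X Y h) u)"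
    if X: "X \<in> S" and X': "X' \<in> S" and Y: "Y \<in> Ob C" and Y': "Y' \<in> Ob C"
      and u: "u \<in> Mor C X' X" and h: "h \<in> Mor C X Y" and v: "v \<in> Mor C Y Y'" for X X' Y Y' u h v
  proof (rule coreflection_inj[OF cr[OF Y'] X'])
    have XO: "X \<in> Ob C" "X' \<in> Ob C" using X X' S by auto
    note l = lift[OF Y X h]
    have lu: "Comp C (lift X Y h) u \<in> Mor C X' (R Y)"
      using Comp_in[OF XO(2,1) RO[OF Y] u l(1)] .
    have hu: "Comp C h u \<in> Mor C X' Y" using Comp_in[OF XO(2,1) Y u h] .
    have vhu: "Comp C v (Comp C h u) \<in> Mor C X' Y'" using Comp_in[OF XO(2) Y Y' hu v] .
    show "lift X' Y' (Comp C v (Comp C h u)) \<in> Mor C X' (R Y')" using lift[OF Y' X' vhu] by simp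
    show "Comp C (mm v) (Comp C (lift X Y h) u) \<in> Mor C X' (R Y')"
      using Comp_in[OF XO(2) RO[OF Y] RO[OF Y'] lu mm(1)[OF Y Y' v]] .
    have "Comp C (e Y') (Comp C (mm v) (Comp C (lift X Y h) u))
      = Comp C (Comp C v (e Y)) (Comp C (lift X Y h) u)"
      using Comp_assoc[OF XO(2) RO[OF Y] RO[OF Y'] Y' lu mm(1)[OF Y Y' v] e[OF Y']]
        mm(2)[OF Y Y' v] by simp
    also have "\<dots> = Comp C v (Comp C (e Y) (Comp C (lift X Y h) u))"
      using Comp_assoc[OF XO(2) RO[OF Y] Y Y' lu e[OF Y] v] by simp
    also have "\<dots> = Comp C v (Comp C h u)"
      using Comp_assoc[OF XO(2,1) RO[OF Y] Y u l(1) e[OF Y]] l(2) by simp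
    finally show "Comp C (e Y') (lift X' Y' (Comp C v (Comp C h u)))
      = Comp C (e Y') (Comp C (mm v) (Comp C (lift X Y h) u))"
      using lift[OF Y' X' vhu] by simp
  qed
  ultimately have "adjunction (full_subcategory C S) C inclusion_functor G"
    unfolding adjunction_def
    by (intro conjI exI[of _ lift])
      (simp_all add: full_subcategory_def inclusion_functor_def G_def)
  then show ?thesis ..
qed

text \<open>The counit \<open>e\<close> is the preimage of the identity of
  \<open>obj_map G X\<close> under the adjunction bijection. Naturality in the first variable gives
  \<Phi>(e u) = u, so composition with \<open>e\<close> is inverse to \<Phi>.\<close>

lemma coreflection_of_right_adjoint:
  assumes S: "S \<subseteq> Ob C" and adj: "adjunction (full_subcategory C S) C inclusion_functor G"
    and X: "X \<in> Ob C"
  shows "\<exists>e. coreflection C S X (obj_map G X) e"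
proof -
  let ?R = "obj_map G X"
  obtain \<Phi> where
    bij: "\<And>Y Z. \<lbrakk>Y \<in> S; Z \<in> Ob C\<rbrakk> \<Longrightarrow> bij_betw (\<Phi> Y Z) (Mor C Y Z) (Mor C Y (obj_map G Z))"
    and nat: "\<And>Y Y' Z Z' u h v. \<lbrakk>Y \<in> S; Y' \<in> S; Z \<in> Ob C; Z' \<in> Ob C; u \<in> Mor C Y' Y;
        h \<in> Mor C Y Z; v \<in> Mor C Z Z'\<rbrakk> \<Longrightarrow> \<Phi> Y' Z' (Comp C v (Comp C h u))
               = Comp C (mor_map G v) (Comp C (\<Phi> Y Z h) u)"
    by (rule adjunctionE[OF adj], rule that) (simp_all add: full_subcategory_def inclusion_functor_def)
  have G: "is_functor C (full_subcategory C S) G"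
    using adj unfolding adjunction_def by simp
  have RS: "?R \<in> S" and GI: "mor_map G (Ident C X) = Ident C ?R"
    using G X unfolding is_functor_def full_subcategory_def by auto
  have RO: "?R \<in> Ob C" using RS S by auto
  obtain e where e: "e \<in> Mor C ?R X" "\<Phi> ?R X e = Ident C ?R"
    using bij[OF RS X] Ident_in[OF RO] unfolding bij_betw_def by (metis imageE)
  have *: "Comp C e u \<in> Mor C Y X" "\<Phi> Y X (Comp C e u) = u"
    if Y: "Y \<in> S" and u: "u \<in> Mor C Y ?R" for Y u
  proof -
    have YO: "Y \<in> Ob C" using Y S by auto
    show eu: "Comp C e u \<in> Mor C Y X" using Comp_in[OF YO RO X u e(1)] .
    show "\<Phi> Y X (Comp C e u) = u"
      using nat[OF RS Y X X u e(1) Ident_in[OF X]]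
      by (simp add: Comp_Ident_left[OF YO X eu] GI e(2) Comp_Ident_left[OF YO RO u])
  qed
  have "bij_betw (Comp C e) (Mor C Y ?R) (Mor C Y X)" if Y: "Y \<in> S" for Y
  proof (rule bij_betw_byWitness[where f' = "\<Phi> Y X"])
    show "\<forall>a\<in>Mor C Y ?R. \<Phi> Y X (Comp C e a) = a"
      and "Comp C e ` Mor C Y ?R \<subseteq> Mor C Y X" using * Y by auto
    show im: "\<Phi> Y X ` Mor C Y X \<subseteq> Mor C Y ?R"
      using bij[OF Y X] unfolding bij_betw_def by auto
    show "\<forall>a'\<in>Mor C Y X. Comp C e (\<Phi> Y X a') = a'"
    proof
      fix k assume k: "k \<in> Mor C Y X"
      then have "\<Phi> Y X k \<in> Mor C Y ?R" using im by auto
      then show "Comp C e (\<Phi> Y X k) = k"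
        using *[OF Y] bij[OF Y X] k unfolding bij_betw_def inj_on_def by blast
    qed
  qed
  then show ?thesis using RS e(1) unfolding coreflection_def by blast
qed

text \<open>Each universal arrow factors through the other, and both composites of the
  factorisations are identities by uniqueness. This is what allows an abstract projection to be
  replaced by a vertex of a triangle.\<close>

lemma coreflection_unique:
  assumes S: "S \<subseteq> Ob C" and X: "X \<in> Ob C"
    and c: "coreflection C S X R e" and c': "coreflection C S X R' e'"
  shows "isomorphic C R R'"
proof -
  have R: "R \<in> S" "e \<in> Mor C R X" and R': "R' \<in> S" "e' \<in> Mor C R' X"
    using c c' unfolding coreflection_def by auto
  then have O: "R \<in> Ob C" "R' \<in> Ob C" using S by auto
  obtain f where f: "f \<in> Mor C R R'" "Comp C e' f = e"
    using coreflection_surj[OF c' R] by blast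
  obtain g where g: "g \<in> Mor C R' R" "Comp C e g = e'"
    using coreflection_surj[OF c R'] by blast
  have "Comp C g f = Ident C R"
    by (rule coreflection_inj[OF c R(1)])
      (use Comp_in[OF O(1,2,1) f(1) g(1)] Ident_in[OF O(1)] Comp_Ident_right[OF O(1) X R(2)]
          Comp_assoc[OF O(1,2,1) X f(1) g(1) R(2)] f g in auto)
  moreover have "Comp C f g = Ident C R'"
    by (rule coreflection_inj[OF c' R'(1)])
      (use Comp_in[OF O(2,1,2) g(1) f(1)] Ident_in[OF O(2)] Comp_Ident_right[OF O(2) X R'(2)]
          Comp_assoc[OF O(2,1,2) X g(1) f(1) R'(2)] f g in auto)
  ultimately have "inverse_morphisms C R R' f g"
    unfolding inverse_morphisms_def using f(1) g(1) by simp
  then show ?thesis unfolding isomorphic_def is_iso_def by blast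
qed

text \<open>On objects of both \<open>S\<close> and \<open>S'\<close>, composition with
  \<open>e'\<close> and then with \<open>e\<close> are bijections of Hom-sets. The condition that
  \<open>R'\<close> falls back into \<open>S\<close> places the result in the intersection.\<close>

lemma coreflection_trans:
  assumes S: "S \<subseteq> Ob C" "S' \<subseteq> Ob C" and X: "X \<in> Ob C"
    and c: "coreflection C S X R e" and c': "coreflection C S' R R' e'" and R': "R' \<in> S"
  shows "coreflection C (S \<inter> S') X R' (Comp C e e')"
proof -
  have e: "R \<in> Ob C" "e \<in> Mor C R X" and e': "R' \<in> S'" "R' \<in> Ob C" "e' \<in> Mor C R' R"
    using c c' S unfolding coreflection_def by auto
  have "bij_betw (Comp C (Comp C e e')) (Mor C Y R') (Mor C Y X)" if Y: "Y \<in> S \<inter> S'" for Y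
  proof -
    have YO: "Y \<in> Ob C" using Y S by auto
    have "bij_betw (Comp C e \<circ> Comp C e') (Mor C Y R') (Mor C Y X)"
      using c c' Y unfolding coreflection_def by (meson IntE bij_betw_trans)
    then show ?thesis
      using Comp_assoc[OF YO e'(2) e(1) X _ e'(3) e(2)]
      by (subst bij_betw_cong[where g = "Comp C e \<circ> Comp C e'"]) auto
  qed
  then show ?thesis
    using Comp_in[OF e'(2) e(1) X e'(3) e(2)] R' e'(1) unfolding coreflection_def by blast
qed

text \<open>Coreflect into the \<open>S i\<close> one after another. Since every single coreflection
  preserves all the \<open>S j\<close>, a later one does not leave the subcategories already
  reached, and \<open>coreflection_trans\<close> applies.\<close>

lemma coreflection_INT:
  assumes "finite I" and S: "\<And>i. i \<in> I \<Longrightarrow> S i \<subseteq> Ob C"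
    and ex: "\<And>i X. \<lbrakk>i \<in> I; X \<in> Ob C\<rbrakk>
      \<Longrightarrow> \<exists>R e. coreflection C (S i) X R e \<and> (\<forall>j \<in> I. X \<in> S j \<longrightarrow> R \<in> S j)"
    and X: "X \<in> Ob C"
  shows "\<exists>R e. coreflection C {Y \<in> Ob C. \<forall>i \<in> I. Y \<in> S i} X R e"
proof -
  have "\<exists>R e. coreflection C {Y \<in> Ob C. \<forall>i \<in> J. Y \<in> S i} X R e" if "finite J" "J \<subseteq> I" for J
    using that
  proof (induction J rule: finite_induct)
    case empty
    \<comment> \<open>The empty intersection is the whole category, where \<open>X\<close> is its
      own coreflection.\<close>
    have "bij_betw (Comp C (Ident C X)) (Mor C Y X) (Mor C Y X)" if "Y \<in> Ob C" for Y
      using Comp_Ident_left[OF that X] bij_betw_cong[of _ "Comp C (Ident C X)" id] by simp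
    then show ?case
      using X Ident_in unfolding coreflection_def by auto
  next
    case (insert j J)
    let ?S = "{Y \<in> Ob C. \<forall>i \<in> J. Y \<in> S i}"
    obtain R e where c: "coreflection C ?S X R e" using insert by auto
    then have R: "R \<in> ?S" unfolding coreflection_def by simp
    obtain R' e' where c': "coreflection C (S j) R R' e'" and st: "\<forall>j \<in> I. R \<in> S j \<longrightarrow> R' \<in> S j"
      using ex[of j R] insert.prems R by auto
    then have "R' \<in> ?S"
      using R insert.prems S unfolding coreflection_def by auto
    moreover have "S j \<subseteq> Ob C" using S insert.prems by auto
    ultimately have "coreflection C (?S \<inter> S j) X R' (Comp C e e')"
      by (intro coreflection_trans[OF _ _ X c c']) auto
    moreover have "?S \<inter> S j = {Y \<in> Ob C. \<forall>i \<in> insert j J. Y \<in> S i}" by auto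
    ultimately show ?case by metis
  qed
  then show ?thesis using \<open>finite I\<close> by auto
qed

end

section \<open>Opposite categories and left adjoints\<close>

definition op_cat :: "('o, 'm, 'z) cat_scheme \<Rightarrow> ('o, 'm) cat" where
  "op_cat C = \<lparr>Ob = Ob C, Mor = (\<lambda>X Y. Mor C Y X), Comp = (\<lambda>g f. Comp C f g), Ident = Ident C\<rparr>"

lemma op_cat_simps [simp]:
  "Ob (op_cat C) = Ob C" "Mor (op_cat C) X Y = Mor C Y X"
  "Comp (op_cat C) g f = Comp C f g" "Ident (op_cat C) X = Ident C X"
  by (simp_all add: op_cat_def)

lemma (in category) category_op_cat: "category (op_cat C)"
proof
  fix X Y X' Y' f
  assume "X \<in> Ob (op_cat C)" "Y \<in> Ob (op_cat C)" "X' \<in> Ob (op_cat C)" "Y' \<in> Ob (op_cat C)"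
    "f \<in> Mor (op_cat C) X Y" "f \<in> Mor (op_cat C) X' Y'"
  then show "X = X' \<and> Y = Y'" using Mor_disjoint[of Y X Y' X' f] by auto
qed (auto simp: Ident_in Comp_in Comp_Ident_left Comp_Ident_right Comp_assoc)

lemma is_functor_op_cat: "is_functor (op_cat C) (op_cat D) F \<longleftrightarrow> is_functor C D F"
  unfolding is_functor_def op_cat_simps by blast

text \<open>The adjunction between the opposite categories provides bijections \<Psi> in the reverse
  direction, so \<Phi> is taken as their inverse. Its naturality follows by applying \<Psi> to the
  right-hand side and cancelling.\<close>

lemma adjunction_op_cat:
  assumes C: "category C" and D: "category D"
    and adj: "adjunction (op_cat D) (op_cat C) G F"
  shows "adjunction C D F G"
proof -
  from adj have F: "is_functor C D F" and G: "is_functor D C G"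
    unfolding adjunction_def is_functor_op_cat by auto
  obtain \<Psi> where
    bij: "\<And>X Y. \<lbrakk>X \<in> Ob C; Y \<in> Ob D\<rbrakk>
      \<Longrightarrow> bij_betw (\<Psi> Y X) (Mor C X (obj_map G Y)) (Mor D (obj_map F X) Y)"
    and nat: "\<And>X X' Y Y' u h v. \<lbrakk>X \<in> Ob C; X' \<in> Ob C; Y \<in> Ob D; Y' \<in> Ob D;
        u \<in> Mor C X' X; h \<in> Mor C X (obj_map G Y); v \<in> Mor D Y Y'\<rbrakk>
      \<Longrightarrow> \<Psi> Y' X' (Comp C (Comp C (mor_map G v) h) u)
        = Comp D (Comp D v (\<Psi> Y X h)) (mor_map F u)"
    by (rule adjunctionE[OF adj], rule that) simp_all
  define \<Phi> where "\<Phi> X Y = inv_into (Mor C X (obj_map G Y)) (\<Psi> Y X)" for X Y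
  have bij': "bij_betw (\<Phi> X Y) (Mor D (obj_map F X) Y) (Mor C X (obj_map G Y))"
    if "X \<in> Ob C" "Y \<in> Ob D" for X Y
    unfolding \<Phi>_def using bij_betw_inv_into[OF bij[OF that]] .
  have inv: "\<Psi> Y X (\<Phi> X Y h) = h" if "X \<in> Ob C" "Y \<in> Ob D" "h \<in> Mor D (obj_map F X) Y" for X Y h
    unfolding \<Phi>_def using bij_betw_inv_into_right[OF bij[OF that(1,2)] that(3)] .
  have inv': "\<Phi> X Y (\<Psi> Y X h) = h" if "X \<in> Ob C" "Y \<in> Ob D" "h \<in> Mor C X (obj_map G Y)" for X Y h
    unfolding \<Phi>_def using bij_betw_inv_into_left[OF bij[OF that(1,2)] that(3)] .
  have "\<Phi> X' Y' (Comp D v (Comp D h (mor_map F u))) = Comp C (mor_map G v) (Comp C (\<Phi> X Y h) u)"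
    if X: "X \<in> Ob C" and X': "X' \<in> Ob C" and Y: "Y \<in> Ob D" and Y': "Y' \<in> Ob D"
      and u: "u \<in> Mor C X' X" and h: "h \<in> Mor D (obj_map F X) Y" and v: "v \<in> Mor D Y Y'"
    for X X' Y Y' u h v
  proof -
    have k: "\<Phi> X Y h \<in> Mor C X (obj_map G Y)"
      using bij'[OF X Y] h unfolding bij_betw_def by auto
    have O: "obj_map F X \<in> Ob D" "obj_map F X' \<in> Ob D" "obj_map G Y \<in> Ob C" "obj_map G Y' \<in> Ob C"
      and Fu: "mor_map F u \<in> Mor D (obj_map F X') (obj_map F X)"
      and Gv: "mor_map G v \<in> Mor C (obj_map G Y) (obj_map G Y')"
      using F G X X' Y Y' u v unfolding is_functor_def by auto
    let ?r = "Comp C (mor_map G v) (Comp C (\<Phi> X Y h) u)"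
    have r: "?r = Comp C (Comp C (mor_map G v) (\<Phi> X Y h)) u"
      using category.Comp_assoc[OF C X' X O(3,4) u k Gv] .
    have "?r \<in> Mor C X' (obj_map G Y')"
      using category.Comp_in[OF C X' O(3,4) category.Comp_in[OF C X' X O(3) u k] Gv] .
    moreover have "\<Psi> Y' X' ?r = Comp D v (Comp D h (mor_map F u))"
      unfolding r nat[OF X X' Y Y' u k v] inv[OF X Y h]
      using category.Comp_assoc[OF D O(2,1) Y Y' Fu h v] by simp
    ultimately show ?thesis using inv'[OF X' Y'] by metis
  qed
  then show ?thesis
    unfolding adjunction_def using F G bij' by (intro conjI exI[of _ \<Phi>]) auto
qed

lemma (in category) category_full_subcategory:
  assumes "S \<subseteq> Ob C" shows "category (full_subcategory C S)"
proof (rule category.intro)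
  fix X Y X' Y' f
  assume "X \<in> Ob (full_subcategory C S)" "Y \<in> Ob (full_subcategory C S)"
    "X' \<in> Ob (full_subcategory C S)" "Y' \<in> Ob (full_subcategory C S)"
    "f \<in> Mor (full_subcategory C S) X Y" "f \<in> Mor (full_subcategory C S) X' Y'"
  then show "X = X' \<and> Y = Y'"
    using Mor_disjoint[of X Y X' Y' f] assms by (auto simp: full_subcategory_def)
qed (use subsetD[OF assms] in \<open>auto simp: full_subcategory_def
    intro: Ident_in Comp_in Comp_Ident_left Comp_Ident_right Comp_assoc\<close>)

text \<open>A reflection of \<open>X\<close> in \<open>S\<close> is a coreflection in the opposite category.\<close>

lemma (in category) left_adjoint_of_reflections:
  assumes S: "S \<subseteq> Ob C" and ex: "\<And>X. X \<in> Ob C \<Longrightarrow> \<exists>L e. coreflection (op_cat C) S X L e"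
  shows "\<exists>F. adjunction C (full_subcategory C S) F inclusion_functor"
proof -
  obtain F where "adjunction (full_subcategory (op_cat C) S) (op_cat C) inclusion_functor F"
    using category.right_adjoint_of_coreflections[OF category_op_cat, of S] assms by auto
  moreover have "full_subcategory (op_cat C) S = op_cat (full_subcategory C S)"
    by (simp add: full_subcategory_def op_cat_def)
  ultimately have "adjunction C (full_subcategory C S) F inclusion_functor"
    using adjunction_op_cat[OF category_axioms category_full_subcategory[OF S]] by simp
  then show ?thesis ..
qed

section \<open>Morphisms in a triangulated category\<close>

abbreviation neg :: "('o, 'm) tricat \<Rightarrow> 'o \<Rightarrow> 'o \<Rightarrow> 'm \<Rightarrow> 'm" where
  "neg T X Y f \<equiv> inv\<^bsub>Mor_group T X Y\<^esub> f"

context additive_category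
begin

lemma Mor_group: "\<lbrakk>X \<in> Ob T; Y \<in> Ob T\<rbrakk> \<Longrightarrow> group (Mor_group T X Y)"
  using Mor_comm_group comm_group_def by blast

lemma Zero_in: "\<lbrakk>X \<in> Ob T; Y \<in> Ob T\<rbrakk> \<Longrightarrow> Zero T X Y \<in> Mor T X Y"
  using monoid.one_closed[OF group.is_monoid[OF Mor_group]] by (simp add: Mor_group_def)

lemma Add_in:
  "\<lbrakk>X \<in> Ob T; Y \<in> Ob T; f \<in> Mor T X Y; g \<in> Mor T X Y\<rbrakk> \<Longrightarrow> Add T X Y f g \<in> Mor T X Y"
  using monoid.m_closed[OF group.is_monoid[OF Mor_group], of X Y f g] by (simp add: Mor_group_def)

lemma Add_Zero: "\<lbrakk>X \<in> Ob T; Y \<in> Ob T; f \<in> Mor T X Y\<rbrakk> \<Longrightarrow> Add T X Y (Zero T X Y) f = f"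
  using monoid.l_one[OF group.is_monoid[OF Mor_group]] by (simp add: Mor_group_def)

lemma Add_idem:
  assumes "X \<in> Ob T" "Y \<in> Ob T" "f \<in> Mor T X Y" "Add T X Y f f = f"
  shows "f = Zero T X Y"
  using group.l_cancel_one[OF Mor_group[OF assms(1,2)], of f f] assms
  by (simp add: Mor_group_def)

lemma neg_in: "\<lbrakk>X \<in> Ob T; Y \<in> Ob T; f \<in> Mor T X Y\<rbrakk> \<Longrightarrow> neg T X Y f \<in> Mor T X Y"
  using group.inv_closed[OF Mor_group, of X Y f] by (simp add: Mor_group_def)

lemma neg_neg: "\<lbrakk>X \<in> Ob T; Y \<in> Ob T; f \<in> Mor T X Y\<rbrakk> \<Longrightarrow> neg T X Y (neg T X Y f) = f"
  using group.inv_inv[OF Mor_group, of X Y f] by (simp add: Mor_group_def)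

lemma neg_Zero: "\<lbrakk>X \<in> Ob T; Y \<in> Ob T\<rbrakk> \<Longrightarrow> neg T X Y (Zero T X Y) = Zero T X Y"
  using monoid.inv_one[OF group.is_monoid[OF Mor_group], of X Y] by (simp add: Mor_group_def)

lemma neg_Add: "\<lbrakk>X \<in> Ob T; Y \<in> Ob T; f \<in> Mor T X Y\<rbrakk> \<Longrightarrow> Add T X Y (neg T X Y f) f = Zero T X Y"
  using group.l_inv[OF Mor_group, of X Y f] by (simp add: Mor_group_def)

lemma neg_unique:
  assumes "X \<in> Ob T" "Y \<in> Ob T" "f \<in> Mor T X Y" "g \<in> Mor T X Y" "Add T X Y g f = Zero T X Y"
  shows "neg T X Y f = g"
  using group.inv_equality[OF Mor_group[OF assms(1,2)], of g f] assms
  by (simp add: Mor_group_def)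

text \<open>By bilinearity the composite equals its own double, hence is zero.\<close>

lemma Comp_Zero_right:
  assumes X: "X \<in> Ob T" and Y: "Y \<in> Ob T" and Z: "Z \<in> Ob T" and g: "g \<in> Mor T Y Z"
  shows "Comp T g (Zero T X Y) = Zero T X Z"
  using Comp_Add_right[OF X Y Z Zero_in[OF X Y] Zero_in[OF X Y] g]
    Add_idem[OF X Z Comp_in[OF X Y Z Zero_in[OF X Y] g]] Add_Zero[OF X Y Zero_in[OF X Y]]
  by simp

lemma Comp_Zero_left:
  assumes X: "X \<in> Ob T" and Y: "Y \<in> Ob T" and Z: "Z \<in> Ob T" and f: "f \<in> Mor T X Y"
  shows "Comp T (Zero T Y Z) f = Zero T X Z"
  using Comp_Add_left[OF X Y Z f Zero_in[OF Y Z] Zero_in[OF Y Z]]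
    Add_idem[OF X Z Comp_in[OF X Y Z f Zero_in[OF Y Z]]] Add_Zero[OF Y Z Zero_in[OF Y Z]]
  by simp

lemma Comp_neg_left:
  assumes X: "X \<in> Ob T" and Y: "Y \<in> Ob T" and Z: "Z \<in> Ob T"
    and f: "f \<in> Mor T X Y" and g: "g \<in> Mor T Y Z"
  shows "Comp T (neg T Y Z g) f = neg T X Z (Comp T g f)"
  using Comp_Add_left[OF X Y Z f neg_in[OF Y Z g] g] neg_Add[OF Y Z g] Comp_Zero_left[OF X Y Z f]
    neg_unique[OF X Z Comp_in[OF X Y Z f g] Comp_in[OF X Y Z f neg_in[OF Y Z g]]]
  by simp

lemma Comp_neg_right:
  assumes X: "X \<in> Ob T" and Y: "Y \<in> Ob T" and Z: "Z \<in> Ob T"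
    and f: "f \<in> Mor T X Y" and g: "g \<in> Mor T Y Z"
  shows "Comp T g (neg T X Y f) = neg T X Z (Comp T g f)"
  using Comp_Add_right[OF X Y Z neg_in[OF X Y f] f g] neg_Add[OF X Y f] Comp_Zero_right[OF X Y Z g]
    neg_unique[OF X Z Comp_in[OF X Y Z f g] Comp_in[OF X Y Z neg_in[OF X Y f] g]]
  by simp

text \<open>Composition with \<open>f\<close> is a homomorphism of abelian groups, so a trivial
  kernel suffices; it is applied to the difference of \<open>k\<close> and \<open>l\<close>.\<close>

lemma inj_on_Comp_left:
  assumes X: "X \<in> Ob T" and Y: "Y \<in> Ob T" and Z: "Z \<in> Ob T" and f: "f \<in> Mor T Y Z"
    and ker: "\<And>k. \<lbrakk>k \<in> Mor T X Y; Comp T f k = Zero T X Z\<rbrakk> \<Longrightarrow> k = Zero T X Y"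
  shows "inj_on (Comp T f) (Mor T X Y)"
proof
  fix k l assume k: "k \<in> Mor T X Y" and l: "l \<in> Mor T X Y" and eq: "Comp T f k = Comp T f l"
  let ?d = "Add T X Y (neg T X Y l) k"
  have "Comp T f ?d = Zero T X Z"
    using Comp_Add_right[OF X Y Z neg_in[OF X Y l] k f] eq Comp_neg_right[OF X Y Z l f]
      neg_Add[OF X Z Comp_in[OF X Y Z l f]] by simp
  then have "?d = Zero T X Y" using ker[OF Add_in[OF X Y neg_in[OF X Y l] k]] by simp
  then show "k = l"
    using neg_unique[OF X Y k neg_in[OF X Y l]] neg_neg[OF X Y k] neg_neg[OF X Y l] by metis
qed

lemma inj_on_Comp_right:
  assumes X: "X \<in> Ob T" and Y: "Y \<in> Ob T" and Z: "Z \<in> Ob T" and f: "f \<in> Mor T X Y"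
    and ker: "\<And>k. \<lbrakk>k \<in> Mor T Y Z; Comp T k f = Zero T X Z\<rbrakk> \<Longrightarrow> k = Zero T Y Z"
  shows "inj_on (\<lambda>k. Comp T k f) (Mor T Y Z)"
proof
  fix k l assume k: "k \<in> Mor T Y Z" and l: "l \<in> Mor T Y Z" and eq: "Comp T k f = Comp T l f"
  let ?d = "Add T Y Z (neg T Y Z l) k"
  have "Comp T ?d f = Zero T X Z"
    using Comp_Add_left[OF X Y Z f neg_in[OF Y Z l] k] eq Comp_neg_left[OF X Y Z f l]
      neg_Add[OF X Z Comp_in[OF X Y Z f l]] by simp
  then have "?d = Zero T Y Z" using ker[OF Add_in[OF Y Z neg_in[OF Y Z l] k]] by simp
  then show "k = l"
    using neg_unique[OF Y Z k neg_in[OF Y Z l]] neg_neg[OF Y Z k] neg_neg[OF Y Z l] by metis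
qed

lemma zero_object_Ob: "is_zero_object T N \<Longrightarrow> N \<in> Ob T"
  by (simp add: is_zero_object_def)

end

section \<open>The shift, rotation, and exactness of Hom\<close>

definition triangle_on :: "('o, 'm) tricat \<Rightarrow> 'o \<Rightarrow> 'o \<Rightarrow> 'o \<Rightarrow> bool" where
  "triangle_on T X Y Z \<longleftrightarrow> (\<exists>f g h. (X, Y, Z, f, g, h) \<in> Dist T)"

context triangulated_category
begin

lemma shift_ob_in: "X \<in> Ob T \<Longrightarrow> shift_ob T X \<in> Ob T"
  using Shift_equivalence unfolding is_equivalence_def is_functor_def by blast

lemma shift_mor_in:
  "\<lbrakk>X \<in> Ob T; Y \<in> Ob T; f \<in> Mor T X Y\<rbrakk> \<Longrightarrow> shift_mor T f \<in> Mor T (shift_ob T X) (shift_ob T Y)"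
  using Shift_equivalence unfolding is_equivalence_def is_functor_def by blast

lemma shift_mor_Ident: "X \<in> Ob T \<Longrightarrow> shift_mor T (Ident T X) = Ident T (shift_ob T X)"
  using Shift_equivalence unfolding is_equivalence_def is_functor_def by blast

lemma shift_mor_Comp:
  "\<lbrakk>X \<in> Ob T; Y \<in> Ob T; Z \<in> Ob T; f \<in> Mor T X Y; g \<in> Mor T Y Z\<rbrakk>
    \<Longrightarrow> shift_mor T (Comp T g f) = Comp T (shift_mor T g) (shift_mor T f)"
  using Shift_equivalence unfolding is_equivalence_def is_functor_def by blast

lemma shift_mor_full:
  assumes "X \<in> Ob T" "Y \<in> Ob T" "f \<in> Mor T (shift_ob T X) (shift_ob T Y)"
  shows "\<exists>f' \<in> Mor T X Y. shift_mor T f' = f"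
proof -
  have "f \<in> shift_mor T ` Mor T X Y"
    using Shift_equivalence assms unfolding is_equivalence_def bij_betw_def by blast
  then show ?thesis by blast
qed

lemma shift_mor_faithful:
  assumes "X \<in> Ob T" "Y \<in> Ob T" "f \<in> Mor T X Y" "f' \<in> Mor T X Y" "shift_mor T f = shift_mor T f'"
  shows "f = f'"
  using Shift_equivalence assms unfolding is_equivalence_def bij_betw_def inj_on_def by blast

lemma shift_mor_Zero:
  assumes X: "X \<in> Ob T" and Y: "Y \<in> Ob T"
  shows "shift_mor T (Zero T X Y) = Zero T (shift_ob T X) (shift_ob T Y)"
  using Add_idem[OF shift_ob_in[OF X] shift_ob_in[OF Y] shift_mor_in[OF X Y Zero_in[OF X Y]]]
    Shift_additive[OF X Y Zero_in[OF X Y] Zero_in[OF X Y]] Add_Zero[OF X Y Zero_in[OF X Y]]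
  by simp

lemma shift_zero_object: "is_zero_object T N \<Longrightarrow> is_zero_object T (shift_ob T N)"
  using shift_ob_in shift_mor_Ident[of N] shift_mor_Zero[of N N] by (simp add: is_zero_object_def)

text \<open>Rotation introduces the morphism -f[1]. That every morphism between shifts has this form
  is what makes it possible to rotate a triangle backwards.\<close>

lemma neg_shift_full:
  assumes X: "X \<in> Ob T" and Y: "Y \<in> Ob T" and f: "f \<in> Mor T (shift_ob T X) (shift_ob T Y)"
  shows "\<exists>f' \<in> Mor T X Y. neg T (shift_ob T X) (shift_ob T Y) (shift_mor T f') = f"
  using shift_mor_full[OF X Y neg_in[OF shift_ob_in[OF X] shift_ob_in[OF Y] f]]
    neg_neg[OF shift_ob_in[OF X] shift_ob_in[OF Y] f] by metis

lemma DistD: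
  assumes "(X, Y, Z, f, g, h) \<in> Dist T"
  shows "X \<in> Ob T" "Y \<in> Ob T" "Z \<in> Ob T"
    "f \<in> Mor T X Y" "g \<in> Mor T Y Z" "h \<in> Mor T Z (shift_ob T X)"
  using Dist_triangle[OF assms] by (auto simp: is_triangle_def)

lemma Dist_rotateD:
  assumes "(X, Y, Z, f, g, h) \<in> Dist T"
  shows "(Y, Z, shift_ob T X, g, h, neg T (shift_ob T X) (shift_ob T Y) (shift_mor T f)) \<in> Dist T"
  using assms Dist_rotate[OF Dist_triangle[OF assms]] by simp

lemma triangle_onD: "triangle_on T X Y Z \<Longrightarrow> X \<in> Ob T \<and> Y \<in> Ob T \<and> Z \<in> Ob T"
  unfolding triangle_on_def using DistD by blast

lemma triangle_on_rotate: "triangle_on T X Y Z \<Longrightarrow> triangle_on T Y Z (shift_ob T X)"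
  unfolding triangle_on_def using Dist_rotateD by blast

text \<open>Exactness of Hom(W, -) at \<open>Y\<close>. Complete \<open>k\<close> and the zero
  morphism to a morphism of triangles from W -> 0 -> W[1] to Y -> Z -> X[1]. Its third component
  W[1] -> X[1] is l[1] for some \<open>l\<close>; the signs of the two rotations cancel, and
  faithfulness of the shift gives f l = k.\<close>

lemma Dist_factor_left:
  assumes D: "(X, Y, Z, f, g, h) \<in> Dist T" and W: "W \<in> Ob T" and k: "k \<in> Mor T W Y"
    and z: "Comp T g k = Zero T W Z"
  shows "\<exists>l \<in> Mor T W X. Comp T f l = k"
proof -
  note d = DistD[OF D]
  let ?s = "shift_ob T" and ?m = "shift_mor T"
  note sO = shift_ob_in[OF W] shift_ob_in[OF d(1)] shift_ob_in[OF d(2)]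
  obtain N where N: "is_zero_object T N" using zero_object_exists by blast
  note NO = zero_object_Ob[OF N]
  have "Comp T g k = Comp T (Zero T N Z) (Zero T W N)"
    using z Comp_Zero_left[OF W NO d(3) Zero_in[OF W NO]] by simp
  from Dist_complete[OF Dist_rotateD[OF Dist_Ident[OF W N]] Dist_rotateD[OF D] k Zero_in[OF NO d(3)] this]
  obtain c where c: "c \<in> Mor T (?s W) (?s X)"
    and eq: "Comp T (neg T (?s X) (?s Y) (?m f)) c
      = Comp T (?m k) (neg T (?s W) (?s W) (?m (Ident T W)))" by blast
  obtain l where l: "l \<in> Mor T W X" "?m l = c" using shift_mor_full[OF W d(1) c] by blast
  note mk = shift_mor_in[OF W d(2) k] and fl = Comp_in[OF W d(1,2) l(1) d(4)]
  have "neg T (?s W) (?s Y) (?m (Comp T f l)) = neg T (?s W) (?s Y) (?m k)"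
    using eq Comp_neg_left[OF sO c shift_mor_in[OF d(1,2,4)]]
      Comp_neg_right[OF sO(1,1,3) _ mk, of "Ident T (?s W)"] Ident_in[OF sO(1)]
      Comp_Ident_right[OF sO(1,3) mk] shift_mor_Comp[OF W d(1,2) l(1) d(4)] l(2)
    by (simp add: shift_mor_Ident[OF W])
  then have "?m (Comp T f l) = ?m k"
    using neg_neg[OF sO(1,3) mk] neg_neg[OF sO(1,3) shift_mor_in[OF W d(2) fl]] by metis
  then have "Comp T f l = k" using shift_mor_faithful[OF W d(2) fl k] by simp
  then show ?thesis using l(1) by blast
qed

text \<open>One rotation turns this into the identity triangle of \<open>W\<close> with the zero
  object N[1].\<close>

lemma Dist_zero_Ident:
  assumes W: "W \<in> Ob T" and N: "is_zero_object T N"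
  shows "(N, W, W, Zero T N W, Ident T W, Zero T W (shift_ob T N)) \<in> Dist T"
proof -
  note NO = zero_object_Ob[OF N]
  note sO = shift_ob_in[OF W] shift_ob_in[OF NO]
  have "is_triangle T (N, W, W, Zero T N W, Ident T W, Zero T W (shift_ob T N))"
    unfolding is_triangle_def using W NO sO Zero_in Ident_in by simp
  from Dist_rotate[OF this] show ?thesis
    using Dist_Ident[OF W shift_zero_object[OF N]] neg_Zero[OF sO(2,1)] shift_mor_Zero[OF NO W]
    by simp
qed

text \<open>Exactness of Hom(-, W) at \<open>Y\<close>: complete the zero morphism and
  \<open>k\<close> to a morphism of triangles into 0 -> W -> W; its third component is the
  factorisation.\<close>

lemma Dist_factor_right:
  assumes D: "(X, Y, Z, f, g, h) \<in> Dist T" and W: "W \<in> Ob T" and k: "k \<in> Mor T Y W"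
    and z: "Comp T k f = Zero T X W"
  shows "\<exists>l \<in> Mor T Z W. Comp T l g = k"
proof -
  note d = DistD[OF D]
  obtain N where N: "is_zero_object T N" using zero_object_exists by blast
  note NO = zero_object_Ob[OF N]
  have "Comp T (Zero T N W) (Zero T X N) = Comp T k f"
    using z Comp_Zero_left[OF d(1) NO W Zero_in[OF d(1) NO]] by simp
  from Dist_complete[OF D Dist_zero_Ident[OF W N] Zero_in[OF d(1) NO] k this]
  show ?thesis using Comp_Ident_left[OF d(2) W k] by metis
qed

text \<open>Pick \<open>f\<close>, \<open>g\<close>, \<open>h\<close> whose negated shifts are the
  three given morphisms. Rotating X -> Y -> Z three times then yields exactly the given
  triangle.\<close>

lemma triangle_on_unshift:
  assumes D: "triangle_on T (shift_ob T X) (shift_ob T Y) (shift_ob T Z)"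
    and X: "X \<in> Ob T" and Y: "Y \<in> Ob T" and Z: "Z \<in> Ob T"
  shows "triangle_on T X Y Z"
proof -
  let ?s = "shift_ob T" and ?m = "shift_mor T"
  obtain u v w where D: "(?s X, ?s Y, ?s Z, u, v, w) \<in> Dist T"
    using D unfolding triangle_on_def by blast
  note d = DistD[OF D]
  obtain f where f: "f \<in> Mor T X Y" "neg T (?s X) (?s Y) (?m f) = u"
    using neg_shift_full[OF X Y d(4)] by blast
  obtain g where g: "g \<in> Mor T Y Z" "neg T (?s Y) (?s Z) (?m g) = v"
    using neg_shift_full[OF Y Z d(5)] by blast
  obtain h where h: "h \<in> Mor T Z (?s X)" "neg T (?s Z) (?s (?s X)) (?m h) = w"
    using neg_shift_full[OF Z d(1,6)] by blast
  have "(X, Y, Z, f, g, h) \<in> Dist T"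
    using Dist_rotate[of X Y Z f g h] Dist_rotate[of Y Z "?s X" g h u]
      Dist_rotate[of Z "?s X" "?s Y" h u v] D d f g h X Y Z
    by (simp add: is_triangle_def)
  then show ?thesis unfolding triangle_on_def by blast
qed

text \<open>The fibre is the cone shifted back. The shift is only essentially surjective, so the
  cone \<open>C\<close> is first replaced by an isomorphic F[1], and the new triangle is then
  rotated backwards.\<close>

lemma Dist_fibre_exists:
  assumes X: "X \<in> Ob T" and Y: "Y \<in> Ob T" and g: "g \<in> Mor T X Y"
  shows "\<exists>F f h. (F, X, Y, f, g, h) \<in> Dist T"
proof -
  let ?s = "shift_ob T" and ?m = "shift_mor T"
  obtain C c d where D: "(X, Y, C, g, c, d) \<in> Dist T" using cone_exists[OF X Y g] by blast
  note dd = DistD[OF D]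
  obtain F where F: "F \<in> Ob T" and iso: "isomorphic T (?s F) C"
    using Shift_equivalence dd(3) unfolding is_equivalence_def by blast
  then obtain i j where ij: "i \<in> Mor T (?s F) C" "j \<in> Mor T C (?s F)"
    "Comp T j i = Ident T (?s F)" "Comp T i j = Ident T C"
    unfolding isomorphic_def is_iso_def inverse_morphisms_def by blast
  note sF = shift_ob_in[OF F] and sX = shift_ob_in[OF X]
  have di: "Comp T d i \<in> Mor T (?s F) (?s X)" using Comp_in[OF sF dd(3) sX ij(1) dd(6)] .
  have jc: "Comp T j c \<in> Mor T Y (?s F)" using Comp_in[OF Y dd(3) sF dd(5) ij(2)] .
  have t: "is_triangle T (X, Y, ?s F, g, Comp T j c, Comp T d i)"
    unfolding is_triangle_def using X Y sF g di jc by simp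
  have id: "is_iso T V V (Ident T V)" if "V \<in> Ob T" for V
    unfolding is_iso_def inverse_morphisms_def
    using Ident_in[OF that] Comp_Ident_left[OF that that Ident_in[OF that]] by blast
  have "Comp T (Comp T d i) j = Comp T (?m (Ident T X)) d"
    using Comp_assoc[OF dd(3) sF dd(3) sX ij(2,1) dd(6)] ij(4)
      Comp_Ident_right[OF dd(3) sX dd(6)] Comp_Ident_left[OF dd(3) sX dd(6)]
    by (simp add: shift_mor_Ident[OF X])
  \<comment> \<open>The isomorphism of triangles is the identity on \<open>X\<close> and
    \<open>Y\<close>, and \<open>j\<close> on the cone.\<close>
  then have D': "(X, Y, ?s F, g, Comp T j c, Comp T d i) \<in> Dist T"
    using Comp_Ident_left[OF X Y g] Comp_Ident_right[OF X Y g] Comp_Ident_right[OF Y sF jc] ij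
    by (intro Dist_iso[OF D t id[OF X] id[OF Y], of j])
      (auto simp: is_iso_def inverse_morphisms_def)
  obtain f where f: "f \<in> Mor T F X" "neg T (?s F) (?s X) (?m f) = Comp T d i"
    using neg_shift_full[OF F X di] by blast
  have "(F, X, Y, f, g, Comp T j c) \<in> Dist T"
    using Dist_rotate[of F X Y f g "Comp T j c"] D' f F X Y g jc by (simp add: is_triangle_def)
  then show ?thesis by blast
qed

end

section \<open>Subcategories and semi-orthogonal decompositions\<close>

definition orthogonal :: "('o, 'm) tricat \<Rightarrow> 'o set \<Rightarrow> 'o set \<Rightarrow> bool" where
  "orthogonal T U V \<longleftrightarrow> (\<forall>X \<in> U. \<forall>Y \<in> V. Mor T X Y = {Zero T X Y})"

lemma orthogonalD:
  "\<lbrakk>orthogonal T U V; X \<in> U; Y \<in> V; f \<in> Mor T X Y\<rbrakk> \<Longrightarrow> f = Zero T X Y"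
  unfolding orthogonal_def by blast

lemma sub_Ob: "strict_triangulated_subcategory T S \<Longrightarrow> S \<subseteq> Ob T"
  by (simp add: strict_triangulated_subcategory_def)

lemma sub_iso:
  "\<lbrakk>strict_triangulated_subcategory T S; X \<in> S; Y \<in> Ob T; isomorphic T X Y\<rbrakk> \<Longrightarrow> Y \<in> S"
  unfolding strict_triangulated_subcategory_def by blast

lemma sub_shift:
  "\<lbrakk>strict_triangulated_subcategory T S; X \<in> Ob T\<rbrakk> \<Longrightarrow> shift_ob T X \<in> S \<longleftrightarrow> X \<in> S"
  unfolding strict_triangulated_subcategory_def by blast

lemma sub_cone:
  "\<lbrakk>strict_triangulated_subcategory T S; triangle_on T X Y Z; X \<in> S; Y \<in> S\<rbrakk> \<Longrightarrow> Z \<in> S"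
  unfolding strict_triangulated_subcategory_def triangle_on_def by blast

section \<open>Filtrations of objects and their rearrangement\<close>

text \<open>The chain of a semi-orthogonal decomposition in recursive form: the head of the list
  contains the cone of the outermost step \<open>Y\<close> -> \<open>X\<close>, and the tail filters
  \<open>Y\<close>. The entries may be arbitrary sets of objects.\<close>

primrec filtered :: "('o, 'm) tricat \<Rightarrow> 'o set list \<Rightarrow> 'o set" where
  "filtered T [] = {X. is_zero_object T X}"
| "filtered T (S # Ss) = {X. \<exists>Y \<in> filtered T Ss. \<exists>Z \<in> S. triangle_on T Y X Z}"

lemma filtered_Cons_mono: "filtered T Ss \<subseteq> filtered T Ss' \<Longrightarrow> filtered T (S # Ss) \<subseteq> filtered T (S # Ss')"
  by auto

lemma filteredD:
  assumes "X \<in> filtered T Ss"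
  shows "\<exists>Xs. Xs 0 = X \<and> is_zero_object T (Xs (length Ss)) \<and>
    (\<forall>i < length Ss. \<exists>Z f g h. (Xs (Suc i), Xs i, Z, f, g, h) \<in> Dist T \<and> Z \<in> Ss ! i)"
  using assms
proof (induction Ss arbitrary: X)
  case Nil
  then show ?case by (intro exI[of _ "\<lambda>_. X"]) simp
next
  case (Cons S Ss)
  from Cons.prems obtain Y Z where Y: "Y \<in> filtered T Ss" and Z: "Z \<in> S" "triangle_on T Y X Z"
    by auto
  from Cons.IH[OF Y] obtain Xs where Xs: "Xs 0 = Y" "is_zero_object T (Xs (length Ss))"
    "\<forall>i < length Ss. \<exists>Z f g h. (Xs (Suc i), Xs i, Z, f, g, h) \<in> Dist T \<and> Z \<in> Ss ! i" by blast
  let ?Xs = "\<lambda>i. case i of 0 \<Rightarrow> X | Suc j \<Rightarrow> Xs j"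
  have "\<exists>Z f g h. (?Xs (Suc i), ?Xs i, Z, f, g, h) \<in> Dist T \<and> Z \<in> (S # Ss) ! i"
    if "i < length (S # Ss)" for i
    using that Z Xs(1,3) unfolding triangle_on_def by (cases i) auto
  then show ?case using Xs(2) by (intro exI[of _ ?Xs]) auto
qed

lemma semiorthogonal_decompositionI:
  assumes "\<And>S. S \<in> set Ss \<Longrightarrow> strict_triangulated_subcategory T S"
    and "sorted_wrt (\<lambda>U V. orthogonal T V U) Ss" and "Ob T \<subseteq> filtered T Ss"
  shows "semiorthogonal_decomposition T Ss"
  unfolding semiorthogonal_decomposition_def
  using assms filteredD[of _ T Ss] unfolding sorted_wrt_iff_nth_less orthogonal_def by blast

context triangulated_category
begin

lemma sub_zero:
  assumes S: "strict_triangulated_subcategory T S" and N: "is_zero_object T N"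
  shows "N \<in> S"
proof -
  obtain X where X: "X \<in> S" using S unfolding strict_triangulated_subcategory_def by blast
  then have "triangle_on T X X N"
    using Dist_Ident[OF _ N] sub_Ob[OF S] unfolding triangle_on_def by blast
  then show ?thesis using sub_cone[OF S] X by blast
qed

text \<open>After a rotation X[1] is a cone of a morphism in \<open>S\<close>, and membership in
  \<open>S\<close> is invariant under the shift.\<close>

lemma sub_fibre:
  assumes S: "strict_triangulated_subcategory T S" and t: "triangle_on T X Y Z"
    and "Y \<in> S" "Z \<in> S"
  shows "X \<in> S"
  using sub_cone[OF S triangle_on_rotate[OF t]] sub_shift[OF S] triangle_onD[OF t] assms by blast

lemma sub_extension:
  assumes S: "strict_triangulated_subcategory T S" and t: "triangle_on T X Y Z"
    and "X \<in> S" "Z \<in> S"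
  shows "Y \<in> S"
  using sub_fibre[OF S triangle_on_rotate[OF t]] sub_shift[OF S] triangle_onD[OF t] assms by blast

lemma strict_triangulated_subcategory_INT:
  assumes "\<And>i. i \<in> I \<Longrightarrow> strict_triangulated_subcategory T (S i)"
  shows "strict_triangulated_subcategory T {X \<in> Ob T. \<forall>i \<in> I. X \<in> S i}"
proof -
  obtain N where N: "is_zero_object T N" using zero_object_exists by blast
  have "N \<in> {X \<in> Ob T. \<forall>i \<in> I. X \<in> S i}"
    using zero_object_Ob[OF N] sub_zero[OF assms N] by blast
  then show ?thesis
    unfolding strict_triangulated_subcategory_def[of T "{X \<in> Ob T. \<forall>i \<in> I. X \<in> S i}"]
    using shift_ob_in sub_iso[OF assms] sub_shift[OF assms] sub_cone[OF assms] DistD(3)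
    unfolding triangle_on_def by blast
qed

text \<open>Let \<open>Z\<close> be the outermost factor of \<open>X\<close>, itself an extension Zv
  -> Z -> Zu, and let \<open>F\<close> be the fibre of the composite X -> Z -> Zu. The octahedral
  axiom gives a triangle Y -> F -> Zv, so one step of the filtration becomes two.\<close>

lemma filtered_refine:
  assumes ext: "\<And>X. X \<in> S \<Longrightarrow> \<exists>Y \<in> V. \<exists>Z \<in> U. triangle_on T Y X Z"
  shows "filtered T (S # Ss) \<subseteq> filtered T (U # V # Ss)"
proof
  fix X assume "X \<in> filtered T (S # Ss)"
  then obtain Y Z where Y: "Y \<in> filtered T Ss" and Z: "Z \<in> S" and t: "triangle_on T Y X Z" by auto
  obtain Zv Zu where Zv: "Zv \<in> V" and Zu: "Zu \<in> U" and t': "triangle_on T Zv Z Zu"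
    using ext[OF Z] by blast
  obtain f g h where D: "(Y, X, Z, f, g, h) \<in> Dist T" using t unfolding triangle_on_def by blast
  obtain f' g' h' where D': "(Zv, Z, Zu, f', g', h') \<in> Dist T"
    using t' unfolding triangle_on_def by blast
  note d = DistD[OF D] and d' = DistD[OF D']
  have c: "Comp T g' g \<in> Mor T X Zu" using Comp_in[OF d(2,3) d'(3) d(5) d'(5)] .
  obtain F p q where E: "(F, X, Zu, p, Comp T g' g, q) \<in> Dist T"
    using Dist_fibre_exists[OF d(2) d'(3) c] by blast
  \<comment> \<open>The octahedral axiom speaks of cones. The fibres are cones of the rotated
    triangles, so all three vertices come out shifted and are shifted back afterwards.\<close>
  have "triangle_on T (shift_ob T Y) (shift_ob T F) (shift_ob T Zv)"
    using octahedron[OF Dist_rotateD[OF D] Dist_rotateD[OF D'] Dist_rotateD[OF E]]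
    unfolding triangle_on_def by blast
  then have "triangle_on T Y F Zv"
    by (rule triangle_on_unshift[OF _ d(1) DistD(1)[OF E] d'(1)])
  then have "F \<in> filtered T (V # Ss)" using Y Zv by auto
  moreover have "triangle_on T F X Zu" using E unfolding triangle_on_def by blast
  ultimately show "X \<in> filtered T (U # V # Ss)" using Zu by auto
qed

text \<open>The connecting morphism of \<open>V \<rightarrow> W \<rightarrow> U \<rightarrow> V[1]\<close> vanishes, so \<open>W \<rightarrow> U\<close> has a section; by the
  octahedron of \<open>U \<rightarrow> W \<rightarrow> U\<close> the cone of the section is \<open>V\<close> up to isomorphism.\<close>

lemma split_extension:
  assumes S: "strict_triangulated_subcategory T S" and D: "(V, W, U, f, g, Zero T U (shift_ob T V)) \<in> Dist T"
    and V: "V \<in> S"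
  shows "\<exists>V' \<in> S. triangle_on T U W V'"
proof -
  note d = DistD[OF D]
  note sV = shift_ob_in[OF d(1)]
  obtain s where s: "s \<in> Mor T U W" "Comp T g s = Ident T U"
    using Dist_factor_left[OF Dist_rotateD[OF D] d(3) Ident_in[OF d(3)]]
      Comp_Ident_right[OF d(3) sV d(6)] by blast
  obtain V' g' h' where E: "(U, W, V', s, g', h') \<in> Dist T" using cone_exists[OF d(3,2) s(1)] by blast
  obtain N where N: "is_zero_object T N" using zero_object_exists by blast
  \<comment> \<open>Only membership of V' in \<open>S\<close> is extracted: V' is the fibre of 0 ->
    V[1].\<close>
  have "triangle_on T V' N (shift_ob T V)"
    using octahedron[OF E Dist_rotateD[OF D]] Dist_Ident[OF d(3) N] s(2)
    unfolding triangle_on_def by metis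
  then have "V' \<in> S" using sub_fibre[OF S] sub_zero[OF S N] sub_shift[OF S d(1)] V by blast
  then show ?thesis using E unfolding triangle_on_def by blast
qed

text \<open>Merge the two outermost steps Y' -> Y -> X; by the octahedral axiom the cone
  \<open>W\<close> of the composite is an extension Zv -> W -> Zu. Its connecting morphism Zu ->
  Zv[1] vanishes because \<open>V\<close> is closed under the shift, so \<open>W\<close> is also an
  extension with the factors in the opposite order, and it can be split up again that way.\<close>

lemma filtered_swap:
  assumes V: "strict_triangulated_subcategory T V" and o: "orthogonal T U V"
  shows "filtered T (U # V # Ss) \<subseteq> filtered T (V # U # Ss)"
proof
  fix X assume "X \<in> filtered T (U # V # Ss)"
  then obtain Y Zu Y' Zv where Y': "Y' \<in> filtered T Ss" and Zu: "Zu \<in> U" and Zv: "Zv \<in> V"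
    and t: "triangle_on T Y X Zu" "triangle_on T Y' Y Zv" by auto
  obtain f f1 f2 where D: "(Y', Y, Zv, f, f1, f2) \<in> Dist T" using t unfolding triangle_on_def by blast
  obtain g g1 g2 where E: "(Y, X, Zu, g, g1, g2) \<in> Dist T" using t unfolding triangle_on_def by blast
  note d = DistD[OF D] and e = DistD[OF E]
  obtain W k1 k2 where F: "(Y', X, W, Comp T g f, k1, k2) \<in> Dist T"
    using cone_exists[OF d(1) e(2) Comp_in[OF d(1,2) e(2) d(4) e(4)]] by blast
  obtain u v c where G: "(Zv, W, Zu, u, v, c) \<in> Dist T" using octahedron[OF D E F] by blast
  have "c = Zero T Zu (shift_ob T Zv)"
    using orthogonalD[OF o Zu _ DistD(6)[OF G]] sub_shift[OF V d(3)] Zv by blast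
  then obtain V' where "V' \<in> V" "triangle_on T Zu W V'"
    using split_extension[OF V _ Zv] G by blast
  \<comment> \<open>The singleton makes \<open>filtered_refine\<close> applicable to the one object
    \<open>W\<close>.\<close>
  then have "filtered T ({W} # Ss) \<subseteq> filtered T (V # U # Ss)"
    using Zu by (intro filtered_refine) auto
  moreover have "triangle_on T Y' X W" using F unfolding triangle_on_def by blast
  then have "X \<in> filtered T ({W} # Ss)" using Y' by auto
  ultimately show "X \<in> filtered T (V # U # Ss)" by blast
qed

lemma filtered_move_front:
  assumes V: "strict_triangulated_subcategory T V" and o: "\<And>U. U \<in> set Us \<Longrightarrow> orthogonal T U V"
  shows "filtered T (Us @ V # Ss) \<subseteq> filtered T (V # Us @ Ss)"
  using o
proof (induction Us)
  case Nil
  then show ?case by simp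
next
  case (Cons U Us)
  have "filtered T (U # Us @ V # Ss) \<subseteq> filtered T (U # V # Us @ Ss)"
    using Cons by (intro filtered_Cons_mono) auto
  also have "\<dots> \<subseteq> filtered T (V # U # Us @ Ss)"
    using Cons.prems by (intro filtered_swap[OF V]) auto
  finally show ?case by simp
qed

text \<open>Locate the first target entry \<open>S\<close> in \<open>Ls\<close>. All entries before
  it come later in the target list, so Hom from them to \<open>S\<close> vanishes and
  \<open>S\<close> can be moved to the front; the rest is sorted by induction. Multisets are
  compared because distinct index sets may give equal pieces, for instance zero ones.\<close>

lemma filtered_reorder:
  assumes "mset Ls = mset Ss" and "\<And>S. S \<in> set Ss \<Longrightarrow> strict_triangulated_subcategory T S"
    and "sorted_wrt (\<lambda>U V. orthogonal T V U) Ss"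
  shows "filtered T Ls \<subseteq> filtered T Ss"
  using assms
proof (induction Ss arbitrary: Ls)
  case Nil
  then show ?case by simp
next
  case (Cons S Ss)
  then have "S \<in> set Ls" by (metis list.set_intros(1) set_mset_mset)
  then obtain Us Vs where Ls: "Ls = Us @ S # Vs" by (meson split_list)
  then have m: "mset (Us @ Vs) = mset Ss" using Cons.prems(1) by simp
  then have "set Us \<subseteq> set Ss" by (metis set_mset_mset set_append sup.cobounded1)
  then have "filtered T Ls \<subseteq> filtered T (S # Us @ Vs)"
    unfolding Ls using Cons.prems by (intro filtered_move_front) auto
  also have "\<dots> \<subseteq> filtered T (S # Ss)"
    using Cons.IH[OF m] Cons.prems by (intro filtered_Cons_mono) auto
  finally show ?case .
qed

section \<open>Decompositions with two components and their projections\<close>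

lemma semiorthogonal_decomposition_pair:
  assumes "semiorthogonal_decomposition T [A, B]"
  shows "strict_triangulated_subcategory T A" "strict_triangulated_subcategory T B"
    "orthogonal T B A"
    "X \<in> Ob T \<Longrightarrow> \<exists>Y \<in> B. \<exists>Z \<in> A. triangle_on T Y X Z"
proof -
  show A: "strict_triangulated_subcategory T A" and B: "strict_triangulated_subcategory T B"
    using assms unfolding semiorthogonal_decomposition_def by auto
  have "\<forall>i j. i < j \<and> j < length [A, B] \<longrightarrow>
      (\<forall>X \<in> [A, B] ! j. \<forall>Y \<in> [A, B] ! i. Mor T X Y = {Zero T X Y})"
    using assms unfolding semiorthogonal_decomposition_def by (elim conjE)
  from spec[OF spec[OF this, of 0], of 1] show "orthogonal T B A" unfolding orthogonal_def by simp
  show "\<exists>Y \<in> B. \<exists>Z \<in> A. triangle_on T Y X Z" if X: "X \<in> Ob T"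
  proof -
    have "\<forall>X \<in> Ob T. \<exists>Xs. Xs 0 = X \<and> is_zero_object T (Xs (length [A, B])) \<and>
        (\<forall>i < length [A, B]. \<exists>Z f g h. (Xs (Suc i), Xs i, Z, f, g, h) \<in> Dist T \<and> Z \<in> [A, B] ! i)"
      using assms unfolding semiorthogonal_decomposition_def by (elim conjE)
    from bspec[OF this X] obtain Xs where Xs: "Xs 0 = X" "is_zero_object T (Xs (length [A, B]))"
      "\<forall>i < length [A, B]. \<exists>Z f g h. (Xs (Suc i), Xs i, Z, f, g, h) \<in> Dist T \<and> Z \<in> [A, B] ! i"
      by (elim exE conjE)
    have "\<exists>Z. triangle_on T (Xs (Suc i)) (Xs i) Z \<and> Z \<in> [A, B] ! i" if "i < length [A, B]" for i
      using Xs(3) that unfolding triangle_on_def by blast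
    from this[of 0] this[of 1] obtain Z Z' where Z: "Z \<in> A" "triangle_on T (Xs 1) X Z"
      and Z': "Z' \<in> B" "triangle_on T (Xs (length [A, B])) (Xs 1) Z'"
      using Xs(1) by auto
    \<comment> \<open>The last object of the chain is zero, so the middle one is an extension of an
      object of \<open>B\<close> by a zero object.\<close>
    have "Xs 1 \<in> B" using sub_extension[OF B Z'(2)] sub_zero[OF B Xs(2)] Z'(1) by blast
    then show ?thesis using Z by blast
  qed
qed

text \<open>Apply Hom(W, -) with \<open>W\<close> in \<open>B\<close>. Surjectivity follows from
  Hom(W, Z) = 0, injectivity from Hom(W[1], Z) = 0.\<close>

lemma coreflection_of_triangle:
  assumes B: "strict_triangulated_subcategory T B" and o: "orthogonal T B A"
    and D: "(Y, X, Z, f, g, h) \<in> Dist T" and Y: "Y \<in> B" and Z: "Z \<in> A"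
  shows "coreflection T B X Y f"
proof -
  note d = DistD[OF D]
  let ?s = "shift_ob T" and ?m = "shift_mor T"
  note sO = shift_ob_in[OF d(1)] shift_ob_in[OF d(2)]
  have "bij_betw (Comp T f) (Mor T W Y) (Mor T W X)" if W: "W \<in> B" for W
    unfolding bij_betw_def
  proof
    have WO: "W \<in> Ob T" using W sub_Ob[OF B] by auto
    note sW = shift_ob_in[OF WO]
    have c: "Comp T f k \<in> Mor T W X" if "k \<in> Mor T W Y" for k
      using Comp_in[OF WO d(1,2) that d(4)] .
    have "k \<in> Comp T f ` Mor T W Y" if k: "k \<in> Mor T W X" for k
      using Dist_factor_left[OF D WO k] orthogonalD[OF o W Z Comp_in[OF WO d(2,3) k d(5)]] by blast
    then show "Comp T f ` Mor T W Y = Mor T W X" using c by auto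
    show "inj_on (Comp T f) (Mor T W Y)"
    proof (rule inj_on_Comp_left[OF WO d(1,2,4)])
      fix k assume k: "k \<in> Mor T W Y" and z: "Comp T f k = Zero T W X"
      note mk = shift_mor_in[OF WO d(1) k] and mf = shift_mor_in[OF d(1,2,4)]
      have "Comp T (neg T (?s Y) (?s X) (?m f)) (?m k) = Zero T (?s W) (?s X)"
        using Comp_neg_left[OF sW sO mk mf] shift_mor_Comp[OF WO d(1,2) k d(4)] z
          shift_mor_Zero[OF WO d(2)] neg_Zero[OF sW sO(2)] by simp
      \<comment> \<open>Exactness at \<open>Y\<close> is read off from the twice rotated triangle Z
        -> Y[1] -> X[1], which is why \<open>k\<close> is shifted first.\<close>
      from Dist_factor_left[OF Dist_rotateD[OF Dist_rotateD[OF D]] sW mk this]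
      obtain l where l: "l \<in> Mor T (?s W) Z" "Comp T h l = ?m k" by blast
      have "l = Zero T (?s W) Z"
        using orthogonalD[OF o _ Z l(1)] sub_shift[OF B WO] W by blast
      then have "?m k = ?m (Zero T W Y)"
        using l(2) Comp_Zero_right[OF sW d(3) sO(1) d(6)] shift_mor_Zero[OF WO d(1)] by simp
      then show "k = Zero T W Y" using shift_mor_faithful[OF WO d(1) k Zero_in[OF WO d(1)]] by blast
    qed
  qed
  then show ?thesis using Y d(4) unfolding coreflection_def by blast
qed

text \<open>Dually, apply Hom(-, W) with \<open>W\<close> in \<open>A\<close>: surjectivity follows
  from Hom(Y, W) = 0, injectivity from Hom(Y[1], W) = 0.\<close>

lemma reflection_of_triangle:
  assumes A: "strict_triangulated_subcategory T A" and B: "strict_triangulated_subcategory T B"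
    and o: "orthogonal T B A"
    and D: "(Y, X, Z, f, g, h) \<in> Dist T" and Y: "Y \<in> B" and Z: "Z \<in> A"
  shows "coreflection (op_cat T) A X Z g"
proof -
  note d = DistD[OF D]
  note sO = shift_ob_in[OF d(1)]
  have "bij_betw (\<lambda>k. Comp T k g) (Mor T Z W) (Mor T X W)" if W: "W \<in> A" for W
    unfolding bij_betw_def
  proof
    have WO: "W \<in> Ob T" using W sub_Ob[OF A] by auto
    have c: "Comp T k g \<in> Mor T X W" if "k \<in> Mor T Z W" for k
      using Comp_in[OF d(2,3) WO d(5) that] .
    have "k \<in> (\<lambda>k. Comp T k g) ` Mor T Z W" if k: "k \<in> Mor T X W" for k
      using Dist_factor_right[OF D WO k] orthogonalD[OF o Y W Comp_in[OF d(1,2) WO d(4) k]] by blast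
    then show "(\<lambda>k. Comp T k g) ` Mor T Z W = Mor T X W" using c by auto
    show "inj_on (\<lambda>k. Comp T k g) (Mor T Z W)"
    proof (rule inj_on_Comp_right[OF d(2,3) WO d(5)])
      fix k assume k: "k \<in> Mor T Z W" and z: "Comp T k g = Zero T X W"
      from Dist_factor_right[OF Dist_rotateD[OF D] WO k z]
      obtain l where l: "l \<in> Mor T (shift_ob T Y) W" "Comp T l h = k" by blast
      have "l = Zero T (shift_ob T Y) W"
        using orthogonalD[OF o _ W l(1)] sub_shift[OF B d(1)] Y by blast
      then show "k = Zero T Z W"
        using l(2) Comp_Zero_left[OF d(3) sO WO d(6)] by simp
    qed
  qed
  then show ?thesis using Z d(5) unfolding coreflection_def by (simp add: op_cat_def)
qed

text \<open>Both \<open>Y\<close> and \<beta>(X) are coreflections of \<open>X\<close> in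
  \<open>B\<close>, hence isomorphic. Strictness of \<open>S\<close> then puts \<open>Y\<close> into
  \<open>S\<close>, and \<open>Z\<close> follows as a cone.\<close>

lemma triangle_of_projection_stable:
  assumes sod: "semiorthogonal_decomposition T [A, B]" and proj: "projection_functor T B \<beta>"
    and S: "strict_triangulated_subcategory T S" and st: "obj_map \<beta> ` S \<subseteq> S" and X: "X \<in> S"
    and t: "triangle_on T Y X Z" and Y: "Y \<in> B" and Z: "Z \<in> A"
  shows "Y \<in> S" "Z \<in> S"
proof -
  note sp = semiorthogonal_decomposition_pair[OF sod]
  have O: "X \<in> Ob T" "Y \<in> Ob T" using triangle_onD[OF t] by auto
  obtain e where e: "coreflection T B X (obj_map \<beta> X) e"
    using coreflection_of_right_adjoint[OF sub_Ob[OF sp(2)] _ O(1)] proj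
    unfolding right_adjoint_of_inclusion_def by blast
  obtain f where "coreflection T B X Y f"
    using coreflection_of_triangle[OF sp(2,3) _ Y Z] t unfolding triangle_on_def by blast
  with e have "isomorphic T (obj_map \<beta> X) Y"
    by (rule coreflection_unique[OF sub_Ob[OF sp(2)] O(1)])
  moreover have "obj_map \<beta> X \<in> S" using st X by auto
  ultimately show "Y \<in> S" using sub_iso[OF S _ O(2)] by blast
  then show "Z \<in> S" using sub_cone[OF S t] X by blast
qed

text \<open>In the triangle Y -> X -> Z the first morphism vanishes, so the identity and the zero
  endomorphism of \<open>Y\<close> agree after composition with it. Universality makes them equal;
  thus \<open>Y\<close> is zero and \<open>X\<close> lies in \<open>A\<close> together with
  \<open>Z\<close>.\<close>

lemma mem_of_right_orthogonal:
  assumes sod: "semiorthogonal_decomposition T [A, B]" and X: "X \<in> Ob T"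
    and o: "\<And>Y k. \<lbrakk>Y \<in> B; k \<in> Mor T Y X\<rbrakk> \<Longrightarrow> k = Zero T Y X"
  shows "X \<in> A"
proof -
  note sp = semiorthogonal_decomposition_pair[OF sod]
  obtain Y Z where Y: "Y \<in> B" and Z: "Z \<in> A" and t: "triangle_on T Y X Z" using sp(4)[OF X] by blast
  then obtain f g h where D: "(Y, X, Z, f, g, h) \<in> Dist T" unfolding triangle_on_def by blast
  note d = DistD[OF D]
  have "f = Zero T Y X" using o[OF Y d(4)] .
  then have "Comp T f (Ident T Y) = Comp T f (Zero T Y Y)"
    using Comp_Ident_right[OF d(1,2,4)] Comp_Zero_right[OF d(1,1,2,4)] by simp
  from coreflection_inj[OF coreflection_of_triangle[OF sp(2,3) D Y Z] Y Ident_in[OF d(1)]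
      Zero_in[OF d(1,1)] this]
  have "is_zero_object T Y" unfolding is_zero_object_def using d(1) by simp
  then show ?thesis using sub_extension[OF sp(1) t] sub_zero[OF sp(1)] Z by blast
qed

text \<open>For \<open>b\<close> in \<open>B'\<close> with reflection \<open>b \<rightarrow> Z\<close> to \<open>A\<close>, \<open>Hom(b, R) = Hom(Z, R) = Hom(Z, X) = 0\<close>
  since \<open>Z\<close> lies again in \<open>B'\<close>; and \<open>A'\<close> is the right orthogonal of \<open>B'\<close>.\<close>

lemma coreflection_stable:
  assumes sod: "semiorthogonal_decomposition T [A, B]"
    and sod': "semiorthogonal_decomposition T [A', B']"
    and st: "\<And>X Y Z. \<lbrakk>X \<in> B'; triangle_on T Y X Z; Y \<in> B; Z \<in> A\<rbrakk> \<Longrightarrow> Z \<in> B'"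
    and X: "X \<in> A'" and cr: "coreflection T A X R e"
  shows "R \<in> A'"
proof -
  note sp = semiorthogonal_decomposition_pair[OF sod]
  note sp' = semiorthogonal_decomposition_pair[OF sod']
  have R: "R \<in> A" and e: "e \<in> Mor T R X" using cr unfolding coreflection_def by auto
  have RO: "R \<in> Ob T" and XO: "X \<in> Ob T" using R X sub_Ob[OF sp(1)] sub_Ob[OF sp'(1)] by auto
  show ?thesis
  proof (rule mem_of_right_orthogonal[OF sod' RO])
    fix b k assume b: "b \<in> B'" and k: "k \<in> Mor T b R"
    have bO: "b \<in> Ob T" using b sub_Ob[OF sp'(2)] by auto
    obtain Y Z where Y: "Y \<in> B" and Z: "Z \<in> A" and t: "triangle_on T Y b Z" using sp(4)[OF bO] by blast
    have Z': "Z \<in> B'" using st[OF b t Y Z] .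
    obtain f g h where D: "(Y, b, Z, f, g, h) \<in> Dist T" using t unfolding triangle_on_def by blast
    note d = DistD[OF D]
    obtain l where l: "l \<in> Mor T Z R" "Comp T l g = k"
      using Dist_factor_right[OF D RO k] orthogonalD[OF sp(3) Y R Comp_in[OF d(1,2) RO d(4) k]]
      by blast
    have "Comp T e l = Comp T e (Zero T Z R)"
      using orthogonalD[OF sp'(3) Z' X Comp_in[OF d(3) RO XO l(1) e]]
        Comp_Zero_right[OF d(3) RO XO e] by simp
    then have "l = Zero T Z R"
      by (rule coreflection_inj[OF cr Z l(1) Zero_in[OF d(3) RO]])
    then show "k = Zero T b R" using l(2) Comp_Zero_left[OF d(2,3) RO d(5)] by simp
  qed
qed

section \<open>Common refinement of several decompositions\<close>

text \<open>Decompose each factor by the next decomposition. Stability keeps both parts inside the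
  piece of \<open>K\<close>, so they lie in the finer pieces of \<open>K\<close> and of
  \<open>K\<close> with the new index added. The length is recorded because it later forces the list
  of index sets to be free of repetitions.\<close>

lemma filtered_pieces:
  assumes sod: "\<And>i. i \<in> {1..n} \<Longrightarrow> semiorthogonal_decomposition T [A i, B i]"
    and st: "\<And>i j X Y Z. \<lbrakk>i \<in> {1..n}; j \<in> {1..n}; triangle_on T Y X Z; Y \<in> B i; Z \<in> A i\<rbrakk>
      \<Longrightarrow> (X \<in> A j \<longrightarrow> Y \<in> A j \<and> Z \<in> A j) \<and> (X \<in> B j \<longrightarrow> Y \<in> B j \<and> Z \<in> B j)"
    and "m \<le> n"
  shows "\<exists>Ks. set Ks = Pow {1..m} \<and> length Ks = 2 ^ m \<and> Ob T \<subseteq> filtered T (map (piece T m A B) Ks)"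
  using \<open>m \<le> n\<close>
proof (induction m)
  case 0
  \<comment> \<open>With no decomposition used yet, the only piece is the whole category, and 0 -> X
    -> X filters \<open>X\<close> by itself.\<close>
  have "Ob T \<subseteq> filtered T [piece T 0 A B {}]"
  proof
    fix X assume X: "X \<in> Ob T"
    obtain N where N: "is_zero_object T N" using zero_object_exists by blast
    have "triangle_on T N X X" using Dist_zero_Ident[OF X N] unfolding triangle_on_def by blast
    then show "X \<in> filtered T [piece T 0 A B {}]" using N X by (auto simp: piece_def)
  qed
  then show ?case by (intro exI[of _ "[{}]"]) simp
next
  case (Suc m)
  let ?P = "piece T m A B" and ?P' = "piece T (Suc m) A B"
  \<comment> \<open>\<open>K\<close> precedes \<open>insert (Suc m) K\<close> because the part in
    \<open>A (Suc m)\<close> is the quotient, hence the outer factor.\<close>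
  let ?r = "\<lambda>Ks. concat (map (\<lambda>K. [K, insert (Suc m) K]) Ks)"
  obtain Ks where Ks: "set Ks = Pow {1..m}" "length Ks = 2 ^ m" "Ob T \<subseteq> filtered T (map ?P Ks)"
    using Suc by auto
  have "set (?r Ks) = Pow {1..m} \<union> insert (Suc m) ` Pow {1..m}" using Ks(1) by auto
  moreover have "length (?r Ls) = 2 * length Ls" for Ls :: "nat set list"
    by (induction Ls) auto
  moreover have ref: "filtered T (?P K # Ss) \<subseteq> filtered T (?P' K # ?P' (insert (Suc m) K) # Ss)"
    if K: "K \<subseteq> {1..m}" for K Ss
  proof (rule filtered_refine)
    fix X assume X: "X \<in> ?P K"
    have i: "Suc m \<in> {1..n}" using Suc.prems by simp
    obtain Y Z where Y: "Y \<in> B (Suc m)" and Z: "Z \<in> A (Suc m)" and t: "triangle_on T Y X Z"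
      using semiorthogonal_decomposition_pair(4)[OF sod[OF i]] X unfolding piece_def by blast
    have "(X \<in> A j \<longrightarrow> Y \<in> A j \<and> Z \<in> A j) \<and> (X \<in> B j \<longrightarrow> Y \<in> B j \<and> Z \<in> B j)" if "j \<in> {1..m}" for j
      using st[OF i _ t Y Z, of j] that Suc.prems by auto
    then have "Y \<in> ?P K \<and> Z \<in> ?P K"
      using X K triangle_onD[OF t] unfolding piece_def by blast
    moreover have "Suc m \<notin> K" using K by auto
    ultimately have "Y \<in> ?P' (insert (Suc m) K) \<and> Z \<in> ?P' K"
      using Y Z unfolding piece_def by (auto simp: atLeastAtMostSuc_conv)
    then show "\<exists>Y \<in> ?P' (insert (Suc m) K). \<exists>Z \<in> ?P' K. triangle_on T Y X Z" using t by blast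
  qed
  have "filtered T (map ?P Ls) \<subseteq> filtered T (map ?P' (?r Ls))" if "set Ls \<subseteq> Pow {1..m}" for Ls
    using that
  proof (induction Ls)
    case Nil
    then show ?case by simp
  next
    case (Cons K Ls)
    have "filtered T (map ?P (K # Ls)) \<subseteq> filtered T (?P K # map ?P' (?r Ls))"
      using Cons unfolding list.map by (intro filtered_Cons_mono) auto
    also have "\<dots> \<subseteq> filtered T (?P' K # ?P' (insert (Suc m) K) # map ?P' (?r Ls))"
      using Cons.prems by (intro ref) auto
    finally show ?case by simp
  qed
  then have "Ob T \<subseteq> filtered T (map ?P' (?r Ks))" using Ks by blast
  moreover have "Pow {1..Suc m} = Pow {1..m} \<union> insert (Suc m) ` Pow {1..m}"
    by (simp add: atLeastAtMostSuc_conv Pow_insert)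
  ultimately show ?case using Ks(2) by (intro exI[of _ "?r Ks"]) simp
qed

end

theorem lemma3p6:
  fixes T :: "('o, 'm) tricat"
    and n :: nat
    and A B :: "nat \<Rightarrow> 'o set"
    and \<beta> :: "nat \<Rightarrow> ('o, 'm, 'o, 'm) cfunctor"
  assumes "triangulated_category T"
    and "\<And>i. i \<in> {1..n} \<Longrightarrow> semiorthogonal_decomposition T [A i, B i]"
    and "\<And>i. i \<in> {1..n} \<Longrightarrow> projection_functor T (B i) (\<beta> i)"
    and "\<And>i j. \<lbrakk>i \<in> {1..n}; j \<in> {1..n}\<rbrakk> \<Longrightarrow> obj_map (\<beta> i) ` A j \<subseteq> A j"
    and "\<And>i j. \<lbrakk>i \<in> {1..n}; j \<in> {1..n}\<rbrakk> \<Longrightarrow> obj_map (\<beta> i) ` B j \<subseteq> B j"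
  shows "(\<forall>Ks :: nat set list.
            distinct Ks \<and> set Ks = Pow {1..n} \<and> sorted (map card Ks) \<longrightarrow>
            semiorthogonal_decomposition T (map (piece T n A B) Ks)) \<and>
         left_admissible T (piece T n A B {}) \<and>
         ((\<forall>i \<in> {1..n}. admissible T (A i)) \<longrightarrow> admissible T (piece T n A B {}))"
proof -
  interpret triangulated_category T by fact
  note sp = semiorthogonal_decomposition_pair[OF assms(2)]
  let ?P = "piece T n A B"
  \<comment> \<open>Stability under the projections is converted into a statement about triangles;
    from here on the functors \<beta> are no longer mentioned.\<close>
  have st: "(X \<in> A j \<longrightarrow> Y \<in> A j \<and> Z \<in> A j) \<and> (X \<in> B j \<longrightarrow> Y \<in> B j \<and> Z \<in> B j)"
    if i: "i \<in> {1..n}" and j: "j \<in> {1..n}" and t: "triangle_on T Y X Z" "Y \<in> B i" "Z \<in> A i"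
    for i j X Y Z
    using triangle_of_projection_stable[OF assms(2,3)[OF i] sp(1)[OF j] assms(4)[OF i j] _ t]
      triangle_of_projection_stable[OF assms(2,3)[OF i] sp(2)[OF j] assms(5)[OF i j] _ t] by blast
  have strict: "strict_triangulated_subcategory T (?P K)" if "K \<subseteq> {1..n}" for K
  proof -
    have "?P K = {X \<in> Ob T. \<forall>i \<in> {1..n}. X \<in> (if i \<in> K then B i else A i)}"
      using that unfolding piece_def by auto
    moreover have "strict_triangulated_subcategory T (if i \<in> K then B i else A i)" if "i \<in> {1..n}" for i
      using sp(1,2)[OF that] by simp
    ultimately show ?thesis
      using strict_triangulated_subcategory_INT[of "{1..n}" "\<lambda>i. if i \<in> K then B i else A i"] by metis
  qed
  have "\<exists>Ls. set Ls = Pow {1..n} \<and> length Ls = 2 ^ n \<and> Ob T \<subseteq> filtered T (map ?P Ls)"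
    by (rule filtered_pieces[of n A B n], erule assms(2), erule st, assumption+, rule order_refl)
  then obtain Ls where Ls: "set Ls = Pow {1..n}" "length Ls = 2 ^ n" "Ob T \<subseteq> filtered T (map ?P Ls)"
    by blast
  have sod: "semiorthogonal_decomposition T (map ?P Ks)"
    if Ks: "distinct Ks" "set Ks = Pow {1..n}" "sorted (map card Ks)" for Ks
  proof -
    have "orthogonal T (?P (Ks ! j)) (?P (Ks ! i))" if ij: "i < j" "j < length Ks" for i j
    proof -
      have sub: "Ks ! i \<subseteq> {1..n}" "Ks ! j \<subseteq> {1..n}" using Ks(2) ij nth_mem[of i Ks] nth_mem[of j Ks] by auto
      have "card (Ks ! i) \<le> card (Ks ! j)"
        using sorted_nth_mono[OF Ks(3), of i j] ij by simp
      moreover have "Ks ! i \<noteq> Ks ! j" using Ks(1) ij by (simp add: nth_eq_iff_index_eq)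
      moreover have "finite (Ks ! i)" using sub finite_subset by blast
      \<comment> \<open>A set at least as large as \<open>Ks ! i\<close> and different from it is
        not contained in it. The index \<open>k\<close> separates the pieces: the later one lies in
        \<open>B k\<close>, the earlier one in \<open>A k\<close>.\<close>
      ultimately obtain k where k: "k \<in> Ks ! j" "k \<notin> Ks ! i" using card_seteq by blast
      then have kn: "k \<in> {1..n}" using sub by auto
      have "?P (Ks ! j) \<subseteq> B k" "?P (Ks ! i) \<subseteq> A k" using k kn unfolding piece_def by auto
      then show ?thesis using sp(3)[OF kn] unfolding orthogonal_def by blast
    qed
    then have o: "sorted_wrt (\<lambda>U V. orthogonal T V U) (map ?P Ks)"
      by (simp add: sorted_wrt_iff_nth_less)
    \<comment> \<open>A list of 2^n entries that runs through 2^n subsets has no repetition.\<close>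
    have "distinct Ls" using Ls(1,2) by (intro card_distinct) (simp add: card_Pow)
    then have m: "mset (map ?P Ls) = mset (map ?P Ks)"
      using Ks(1,2) Ls(1) set_eq_iff_mset_eq_distinct[of Ls Ks] by (metis mset_map)
    have s: "strict_triangulated_subcategory T S" if "S \<in> set (map ?P Ks)" for S
      using strict Ks(2) that by auto
    show ?thesis
      by (rule semiorthogonal_decompositionI[OF s o subset_trans[OF Ls(3) filtered_reorder[OF m s o]]])
  qed
  have P: "?P {} = {X \<in> Ob T. \<forall>i \<in> {1..n}. X \<in> A i}" unfolding piece_def by auto
  have PO: "?P {} \<subseteq> Ob T" unfolding P by auto
  \<comment> \<open>The reflection in \<open>A i\<close> is the third vertex of the triangle, so
    \<open>st\<close> shows that it preserves every \<open>A j\<close>.\<close>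
  have refl: "\<exists>L e. coreflection (op_cat T) (A i) X L e \<and> (\<forall>j \<in> {1..n}. X \<in> A j \<longrightarrow> L \<in> A j)"
    if i: "i \<in> {1..n}" and X: "X \<in> Ob T" for i X
  proof -
    obtain Y Z where t: "triangle_on T Y X Z" "Y \<in> B i" "Z \<in> A i" using sp(4)[OF i X] by blast
    then show ?thesis
      using reflection_of_triangle[OF sp(1-3)[OF i] _ t(2,3)] st[OF i _ t]
      unfolding triangle_on_def by blast
  qed
  have L: "\<exists>L. left_adjoint_of_inclusion T (?P {}) L"
    unfolding left_adjoint_of_inclusion_def
  proof (rule left_adjoint_of_reflections[OF PO])
    show "\<exists>L e. coreflection (op_cat T) (?P {}) X L e" if "X \<in> Ob T" for X
      \<comment> \<open>Composing reflections is composing coreflections in the opposite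
        category.\<close>
      using category.coreflection_INT[OF category_op_cat, of "{1..n}" A X]
        sub_Ob[OF sp(1)] refl that unfolding P by simp
  qed
  have R: "\<exists>R. right_adjoint_of_inclusion T (?P {}) R" if adm: "\<forall>i \<in> {1..n}. admissible T (A i)"
    unfolding right_adjoint_of_inclusion_def
  proof (rule right_adjoint_of_coreflections[OF PO])
    \<comment> \<open>The right adjoints come from admissibility of the \<open>A i\<close>; that
      each preserves every \<open>A j\<close> is \<open>coreflection_stable\<close>, fed with the
      stability of \<open>B j\<close> under reflection to \<open>A i\<close>.\<close>
    have "\<exists>R e. coreflection T (A i) X R e \<and> (\<forall>j \<in> {1..n}. X \<in> A j \<longrightarrow> R \<in> A j)"
      if i: "i \<in> {1..n}" and X: "X \<in> Ob T" for i X
    proof -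
      obtain G where "adjunction (full_subcategory T (A i)) T inclusion_functor G"
        using adm i unfolding admissible_def right_adjoint_of_inclusion_def by blast
      from coreflection_of_right_adjoint[OF sub_Ob[OF sp(1)[OF i]] this X]
      obtain R e where "coreflection T (A i) X R e" by blast
      then show ?thesis
        using coreflection_stable[OF assms(2)[OF i] assms(2)] st[OF i] by blast
    qed
    then show "\<exists>R e. coreflection T (?P {}) X R e" if "X \<in> Ob T" for X
      using coreflection_INT[of "{1..n}" A X] sub_Ob[OF sp(1)] that unfolding P by simp
  qed
  show ?thesis
    using sod L R strict[of "{}"] unfolding left_admissible_def admissible_def by blast
qed

end
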